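(* For any $\mu,L,\Delta,\epsilon>0$ such that $\kappa:=L/\mu\ge 1$, there exists a function $f:\mathbb{R}^m\times\mathbb{R}^n\to\mathbb{R}$ in $\mathcal{F}(L,\mu,\Delta)$, for some $m,n\in\mathbb{N}$, with its deterministic first-order oracle, such that for any first-order (zero-respecting) algorithm, initialized at the origin and producing iterates $(\boldsymbol{x}^t,\boldsymbol{y}^t)$, one has $$\|\nabla f_m(\boldsymbol{x}^t)\|_2>\epsilon,\qquad\text{where } f_m(\boldsymbol{x}):=\max_{\boldsymbol{y}\in\mathbb{R}^n}f(\boldsymbol{x};\boldsymbol{y}),$$ whenever $$t\le\frac{c_0L\Delta\sqrt{\kappa}}{\epsilon^2}.$$ Here $c_0>0$ is a numerical constant (not depending on $\mu,L,\Delta,\epsilon$).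
   Context: Function class. For $L\ge\mu>0$ and $\Delta>0$, $\mathcal{F}(L,\mu,\Delta)$ is the set of all functions $f:\mathcal{X}\times\mathcal{Y}\to\mathbb{R}$, for some nonempty closed convex sets $\mathcal{X}\subset\mathbb{R}^m$, $\mathcal{Y}\subset\mathbb{R}^n$ with $m,n\in\mathbb{N}$, such that: (1) $f$ is $L$-smooth: $\|\nabla f(\boldsymbol{x}_1;\boldsymbol{y}_1)-\nabla f(\boldsymbol{x}_2;\boldsymbol{y}_2)\|_2\le L\|(\boldsymbol{x}_1,\boldsymbol{y}_1)-(\boldsymbol{x}_2,\boldsymbol{y}_2)\|_2$ for all $\boldsymbol{x}_1,\boldsymbol{x}_2\in\mathcal{X}$, $\boldsymbol{y}_1,\boldsymbol{y}_2\in\mathcal{Y}$; (2) for each fixed $\boldsymbol{x}\in\mathcal{X}$, $f$ is $\mu$-strongly concave in $\boldsymbol{y}$: $f(\boldsymbol{x};\boldsymbol{y}_1)\le f(\boldsymbol{x};\boldsymbol{y}_2)+\nabla_{\boldsymbol{y}}f(\boldsymbol{x};\boldsymbol{y}_2)\cdot(\boldsymbol{y}_1-\boldsymbol{y}_2)-\frac{1}{2}\mu\|\boldsymbol{y}_1-\boldsymbol{y}_2\|_2^2$ for all $\boldsymbol{y}_1,\boldsymbol{y}_2\in\mathcal{Y}$; (3) $f_m(\mathbf{0})-\min_{\boldsymbol{x}\in\mathcal{X}}f_m(\boldsymbol{x})\le\Delta$, where $f_m(\boldsymbol{x}):=\max_{\boldsymbol{y}\in\mathcal{Y}}f(\boldsymbol{x};\boldsymbol{y})$.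 Oracle. The deterministic first-order oracle of a differentiable function $g:\mathcal{V}\to\mathbb{R}$ maps $\boldsymbol{v}\in\mathcal{V}$ to $(g(\boldsymbol{v}),\nabla g(\boldsymbol{v}))$. Algorithms. For a vector $\boldsymbol{v}$, $\mathrm{supp}(\boldsymbol{v})=\{i:v_i\ne0\}$, and $\mathsf{P}_{\mathcal V}$ is Euclidean projection onto the nonempty closed convex set $\mathcal{V}$. A first-order (zero-respecting) algorithm is one that, for any function $g:\mathcal{V}\to\mathbb{R}$ with an associated first-order oracle returning $(g(\boldsymbol{v}^i),\boldsymbol{g}^i)$ at the iterate $\boldsymbol{v}^i$, produces iterates $\boldsymbol{v}^0,\boldsymbol{v}^1,\dots$ satisfying $$\boldsymbol{v}^{t+1}\in\Big\{\mathsf{P}_{\mathcal{V}}(\boldsymbol{w}):\ \mathrm{supp}(\boldsymbol{w})\subset\bigcup_{0\le i\le t}\big(\mathrm{supp}(\boldsymbol{v}^i)\cup\mathrm{supp}(\boldsymbol{g}^i)\big)\Big\}.$$ For a min-max objective $f(\boldsymbol{x};\boldsymbol{y})$ this is applied to the joint variable $\boldsymbol{v}=(\boldsymbol{x},\boldsymbol{y})$, with $\boldsymbol{v}^t=(\boldsymbol{x}^t,\boldsymbol{y}^t)$ and $\boldsymbol{v}^0=\mathbf{0}$.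
   Formalization: The bound on t is claimed only when c_0 L Δ √κ/ε² ≥ 1; this drops only t = 0 when that quantity is below 1, where the claim fails for large ε because ‖∇f_m(0)‖² ≤ 4κLΔ for every f in the class. *)

theory Defs
  imports "HOL-Analysis.Analysis"
begin

section \<open>Euclidean spaces of varying dimension\<close>

text \<open>
  The dimensions are existentially quantified after the real parameters of the problem, so they
  cannot be types. All spaces $R^d$ are therefore embedded in one inner product space, the
  finitely supported real sequences with the $l^2$ inner product: $R^d$ is the subspace
  of the sequences that vanish from index \<open>d\<close> on, with its Euclidean norm and topology
  (it is a closed subspace, so relatively closed subsets of it are exactly its closed subsets).
  The product type carries the norm $\sqrt{\|x\|^2 + \|y\|^2}$, as required for joint variables.
  The library type \<open>'a \<Rightarrow>\<^sub>0 'b\<close> is not used because HOL-Analysis equips it with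
  the $l^1$ norm.
\<close>

typedef rvec = "{v :: nat \<Rightarrow> real. finite {i. v i \<noteq> 0}}"
  morphisms coord Abs_rvec
  by (rule exI[of _ "\<lambda>_. 0"]) simp

setup_lifting type_definition_rvec

definition supp :: "rvec \<Rightarrow> nat set" where
  "supp v = {i. coord v i \<noteq> 0}"

lemma finite_coord [simp]: "finite {i. coord v i \<noteq> 0}"
  using coord[of v] by simp

lemma finite_supp [simp]: "finite (supp v)"
  by (simp add: supp_def)

lemma rvec_eqI: "(\<And>i. coord u i = coord v i) \<Longrightarrow> u = v"
  by (metis coord_inject ext)

instantiation rvec :: real_vector
begin

lift_definition zero_rvec :: rvec is "\<lambda>_. 0" by simp

lift_definition plus_rvec :: "rvec \<Rightarrow> rvec \<Rightarrow> rvec" is "\<lambda>u v i. u i + v i"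
proof -
  fix u v :: "nat \<Rightarrow> real"
  assume "finite {i. u i \<noteq> 0}" "finite {i. v i \<noteq> 0}"
  then show "finite {i. u i + v i \<noteq> 0}"
    by (rule finite_subset[rotated, OF finite_UnI]) auto
qed

lift_definition uminus_rvec :: "rvec \<Rightarrow> rvec" is "\<lambda>v i. - v i" by simp

lift_definition minus_rvec :: "rvec \<Rightarrow> rvec \<Rightarrow> rvec" is "\<lambda>u v i. u i - v i"
proof -
  fix u v :: "nat \<Rightarrow> real"
  assume "finite {i. u i \<noteq> 0}" "finite {i. v i \<noteq> 0}"
  then show "finite {i. u i - v i \<noteq> 0}"
    by (rule finite_subset[rotated, OF finite_UnI]) auto
qed

lift_definition scaleR_rvec :: "real \<Rightarrow> rvec \<Rightarrow> rvec" is "\<lambda>c v i. c * v i"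
proof -
  fix c :: real and v :: "nat \<Rightarrow> real"
  assume "finite {i. v i \<noteq> 0}"
  then show "finite {i. c * v i \<noteq> 0}"
    by (rule finite_subset[rotated]) auto
qed

instance
  by standard (transfer; simp add: algebra_simps fun_eq_iff)+

end

lemma coord_simps [simp]:
  "coord 0 i = 0"
  "coord (u + v) i = coord u i + coord v i"
  "coord (u - v) i = coord u i - coord v i"
  "coord (- v) i = - coord v i"
  "coord (c *\<^sub>R v) i = c * coord v i"
  by (transfer, simp)+

instantiation rvec :: real_inner
begin

definition inner_rvec :: "rvec \<Rightarrow> rvec \<Rightarrow> real" where
  "inner_rvec u v = (\<Sum>i \<in> supp u \<union> supp v. coord u i * coord v i)"

definition norm_rvec :: "rvec \<Rightarrow> real" where
  "norm_rvec v = sqrt (inner v v)"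

definition sgn_rvec :: "rvec \<Rightarrow> rvec" where
  "sgn_rvec v = v /\<^sub>R norm v"

definition dist_rvec :: "rvec \<Rightarrow> rvec \<Rightarrow> real" where
  "dist_rvec u v = norm (u - v)"

definition uniformity_rvec :: "(rvec \<times> rvec) filter" where
  "uniformity_rvec = (INF e\<in>{0<..}. principal {(u, v). dist u v < e})"

definition open_rvec :: "rvec set \<Rightarrow> bool" where
  "open_rvec U \<longleftrightarrow> (\<forall>u\<in>U. \<forall>\<^sub>F (u', v) in uniformity. u' = u \<longrightarrow> v \<in> U)"

lemma inner_rvec_superset:
  assumes "finite S" and "supp u \<inter> supp v \<subseteq> S"
  shows "inner u v = (\<Sum>i\<in>S. coord u i * coord v i)"
proof -
  have "inner u v = (\<Sum>i\<in>supp u \<inter> supp v. coord u i * coord v i)"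
    unfolding inner_rvec_def by (rule sum.mono_neutral_right) (simp_all add: supp_def, auto)
  also have "\<dots> = (\<Sum>i\<in>S. coord u i * coord v i)"
    using assms by (intro sum.mono_neutral_left) (auto simp: supp_def)
  finally show ?thesis .
qed

instance
proof
  fix u v w :: rvec and c :: real
  show "inner u v = inner v u"
    by (simp add: inner_rvec_def mult.commute Un_commute)
  define S where "S = supp u \<union> supp v \<union> supp w \<union> supp (u + v)"
  have "finite S" by (simp add: S_def)
  then show "inner (u + v) w = inner u w + inner v w"
    by (subst (1 2 3) inner_rvec_superset[of S])
      (auto simp: S_def distrib_right sum.distrib)
  show "inner (c *\<^sub>R u) v = c * inner u v"
    by (subst (1 2) inner_rvec_superset[of "supp u"])
      (auto simp: supp_def[of "c *\<^sub>R u"] supp_def[of u]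
        sum_distrib_left mult.assoc)
  show "0 \<le> inner u u"
    by (simp add: inner_rvec_def sum_nonneg)
  show "inner u u = 0 \<longleftrightarrow> u = 0"
  proof
    assume "inner u u = 0"
    then have "coord u i = 0" for i
      by (auto simp: inner_rvec_def sum_nonneg_eq_0_iff supp_def)
    then show "u = 0"
      by (intro rvec_eqI) simp
  qed (simp add: inner_rvec_def)
qed (rule sgn_rvec_def norm_rvec_def dist_rvec_def uniformity_rvec_def open_rvec_def)+

end

definition Rn :: "nat \<Rightarrow> rvec set" where
  "Rn d = {v. \<forall>i\<ge>d. coord v i = 0}"

type_synonym joint = "rvec \<times> rvec"

text \<open>Support of a joint variable, with disjoint index sets for the two blocks.\<close>

definition jsupp :: "joint \<Rightarrow> (nat + nat) set" where
  "jsupp v = supp (fst v) <+> supp (snd v)"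


section \<open>Gradients and the function class\<close>

text \<open>
  \<open>has_grad E g G v V\<close>: the function \<open>g\<close> on \<open>V\<close>, a subset of the Euclidean space \<open>E\<close>, has
  gradient \<open>G \<in> E\<close> at \<open>v\<close>. Nothing outside \<open>V\<close> matters. If \<open>V = E\<close> then \<open>G\<close> is unique; the
  side condition \<open>G \<in> E\<close> excludes components orthogonal to the subspace \<open>E\<close>.
\<close>

definition has_grad ::
    "'a::real_inner set \<Rightarrow> ('a \<Rightarrow> real) \<Rightarrow> 'a \<Rightarrow> 'a \<Rightarrow> 'a set \<Rightarrow> bool" where
  "has_grad E g G v V \<longleftrightarrow> G \<in> E \<and> (g has_derivative (\<lambda>h. inner G h)) (at v within V)"

definition max_fun :: "(joint \<Rightarrow> real) \<Rightarrow> rvec set \<Rightarrow> rvec \<Rightarrow> real" where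
  "max_fun f Y x = (GREATEST z. z \<in> (\<lambda>y. f (x, y)) ` Y)"

text \<open>
  The functions of the class whose domain is \<open>X \<times> Y\<close> with \<open>X\<close> in $R^m$ and \<open>Y\<close> in $R^n$.
  The maximum in \<^const>\<open>max_fun\<close> is attained because \<open>Y\<close> is closed and \<open>f\<close> is strongly
  concave in \<open>y\<close>. That the minimum of the max-function over \<open>X\<close> is attained is part of the last
  condition, and so is \<open>0 \<in> X\<close>, as its value at the origin is used.
\<close>

definition fun_class ::
    "real \<Rightarrow> real \<Rightarrow> real \<Rightarrow> nat \<Rightarrow> nat \<Rightarrow> rvec set \<Rightarrow> rvec set \<Rightarrow> (joint \<Rightarrow> real) set" where
  "fun_class L \<mu> \<Delta> m n X Y = {f.
     X \<noteq> {} \<and> closed X \<and> convex X \<and> X \<subseteq> Rn m \<and>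
     Y \<noteq> {} \<and> closed Y \<and> convex Y \<and> Y \<subseteq> Rn n \<and>
     (\<exists>G. (\<forall>v \<in> X \<times> Y. has_grad (Rn m \<times> Rn n) f (G v) v (X \<times> Y)) \<and>
          L-lipschitz_on (X \<times> Y) G \<and>
          (\<forall>x\<in>X. \<forall>y1\<in>Y. \<forall>y2\<in>Y.
             f (x, y1) \<le> f (x, y2) + inner (snd (G (x, y2))) (y1 - y2)
                         - 1/2 * \<mu> * (norm (y1 - y2))\<^sup>2)) \<and>
     0 \<in> X \<and>
     (\<exists>x0. is_arg_min (max_fun f Y) (\<lambda>x. x \<in> X) x0 \<and>
           max_fun f Y 0 - max_fun f Y x0 \<le> \<Delta>)}"


section \<open>Oracles and zero-respecting algorithms\<close>

type_synonym fo_oracle = "joint \<Rightarrow> real \<times> joint"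

definition first_order_oracle ::
    "nat \<Rightarrow> nat \<Rightarrow> joint set \<Rightarrow> (joint \<Rightarrow> real) \<Rightarrow> fo_oracle \<Rightarrow> bool" where
  "first_order_oracle m n V g Orc \<longleftrightarrow>
     (\<forall>v\<in>V. fst (Orc v) = g v \<and> has_grad (Rn m \<times> Rn n) g (snd (Orc v)) v V)"

text \<open>\<open>is_proj V w p\<close>: the point \<open>p\<close> is the Euclidean projection of \<open>w\<close> onto \<open>V\<close>.\<close>

definition is_proj :: "'a::metric_space set \<Rightarrow> 'a \<Rightarrow> 'a \<Rightarrow> bool" where
  "is_proj V w p \<longleftrightarrow> is_arg_min (dist w) (\<lambda>u. u \<in> V) p"

definition zero_respecting :: "joint set \<Rightarrow> fo_oracle \<Rightarrow> (nat \<Rightarrow> joint) \<Rightarrow> bool" where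
  "zero_respecting V Orc v \<longleftrightarrow> v 0 \<in> V \<and>
     (\<forall>t. \<exists>w. jsupp w \<subseteq> (\<Union>i\<le>t. jsupp (v i) \<union> jsupp (snd (Orc (v i)))) \<and>
              is_proj V w (v (Suc t)))"

text \<open>
  An algorithm produces a sequence of iterates for every problem, that is, for every nonempty
  closed convex domain (with the dimensions of the two blocks) and every first-order oracle
  of a differentiable function on that domain.
\<close>

type_synonym algorithm = "nat \<Rightarrow> nat \<Rightarrow> joint set \<Rightarrow> fo_oracle \<Rightarrow> nat \<Rightarrow> joint"

definition first_order_algorithm :: "algorithm \<Rightarrow> bool" where
  "first_order_algorithm A \<longleftrightarrow>
     (\<forall>m n V g Orc. V \<noteq> {} \<and> closed V \<and> convex V \<and> V \<subseteq> Rn m \<times> Rn n \<and>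
        first_order_oracle m n V g Orc \<longrightarrow> zero_respecting V Orc (A m n V Orc))"

end

theory Submission
  imports Defs
begin

text \<open>
  The maximum function is, up to scaling, the nonconvex chain
  $\frac q2 \sum_{i<T} (z_i - z_{i+1})^2 + s \sum_{i<T} \phi(z_{i+1})$ with a fixed source
  $z_0 = \sigma$ and $z_{i+1} = x_i$. The potential $\phi$ decreases up to its minimum at $\sigma$
  and is stationary at the origin. As long as $x_{T-1} = 0$ the gradient of this chain is large,
  although the function can only decrease by an amount proportional to $T$.

  Each link between $z_i$ and $z_{i+1}$ is produced by maximizing over a path of $n$ variables $y$
  that is driven at its two ends, so a zero-respecting algorithm needs $n$ steps to cross it.
  Strong concavity permits $n$ of order $\sqrt\kappa$, and $T$ of order $L\Delta/\epsilon^2$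
  is compatible with the gap. If $L\Delta/\epsilon^2$ is small, a single link without $\phi$ and a
  path shorter by that factor suffices; if $\kappa$ is bounded, the links are put into the
  objective directly, without the path.
\<close>

section \<open>Coordinates and gradients\<close>

lemma inner_Rn:
  assumes "u \<in> Rn d"
  shows "inner u v = (\<Sum>i<d. coord u i * coord v i)"
  using assms
  by (intro inner_rvec_superset) (auto simp: Rn_def supp_def not_le[symmetric])

lemma less_if_mem_Rn: "v \<in> Rn d \<Longrightarrow> coord v i \<noteq> 0 \<Longrightarrow> i < d"
  by (metis (mono_tags, lifting) Rn_def mem_Collect_eq not_less)

lemma norm_Rn: "u \<in> Rn d \<Longrightarrow> (norm u)\<^sup>2 = (\<Sum>i<d. (coord u i)\<^sup>2)"
  unfolding power2_norm_eq_inner by (simp add: inner_Rn power2_eq_square)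

lemma mem_Rn_max: "v \<in> Rn (Suc (Max (insert 0 (supp v))))"
  unfolding Rn_def
proof clarify
  fix i assume i: "Suc (Max (insert 0 (supp v))) \<le> i"
  show "coord v i = 0"
  proof (rule ccontr)
    assume "coord v i \<noteq> 0"
    then have "i \<le> Max (insert 0 (supp v))" by (intro Max_ge) (auto simp: supp_def)
    with i show False by simp
  qed
qed

lemma coord_le_norm: "\<bar>coord v i\<bar> \<le> norm v"
proof (cases "coord v i = 0")
  case False
  obtain d where d: "v \<in> Rn d" using mem_Rn_max by blast
  with False have "i < d" by (auto simp: Rn_def not_le[symmetric])
  then have "(coord v i)\<^sup>2 \<le> (norm v)\<^sup>2"
    unfolding norm_Rn[OF d] by (intro member_le_sum) auto
  then show ?thesis
    by (metis abs_le_square_iff abs_norm_cancel)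
qed simp

lemma bounded_linear_coord: "bounded_linear (\<lambda>v. coord v i)"
  by (rule bounded_linear_intro[where K = 1]) (auto simp: coord_le_norm)

lemmas has_derivative_coord [derivative_intros] =
  bounded_linear.has_derivative[OF bounded_linear_coord]

lemma subspace_Rn: "subspace (Rn d)"
  by (auto simp: subspace_def Rn_def)

lemma closed_Rn: "closed (Rn d)"
proof -
  have "closed (\<Inter>i\<in>{d..}. {v. coord v i = 0})"
    by (intro closed_INT ballI closed_Collect_eq continuous_on_const
        linear_continuous_on bounded_linear_coord)
  also have "(\<Inter>i\<in>{d..}. {v. coord v i = 0}) = Rn d"
    by (auto simp: Rn_def)
  finally show ?thesis .
qed

section \<open>Vectors from coordinates and Riesz representation of derivatives\<close>

definition vec :: "nat \<Rightarrow> (nat \<Rightarrow> real) \<Rightarrow> rvec" where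
  "vec d g = Abs_rvec (\<lambda>i. if i < d then g i else 0)"

lemma coord_vec [simp]: "coord (vec d g) i = (if i < d then g i else 0)"
proof -
  have "finite {i. (if i < d then g i else 0) \<noteq> 0}"
    by (rule finite_subset[of _ "{..<d}"]) (auto split: if_splits)
  then show ?thesis by (simp add: vec_def Abs_rvec_inverse)
qed

lemma vec_mem_Rn [simp]: "vec d g \<in> Rn d"
  by (simp add: Rn_def)

definition unit :: "nat \<Rightarrow> rvec" where
  "unit j = vec (Suc j) (\<lambda>i. of_bool (i = j))"

lemma coord_unit [simp]: "coord (unit j) i = of_bool (i = j)"
  by (auto simp: unit_def)

lemma coord_sum: "coord (sum g S) i = (\<Sum>k\<in>S. coord (g k) i)"
  by (induction S rule: infinite_finite_induct) auto

text \<open>A functional blind to the coordinates from \<open>d\<close> on factors through the first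
  \<open>d\<close> unit vectors, so a finite sum represents it by a vector inside
  \<open>Rn d\<close>, as \<open>has_grad\<close> demands. The finitely supported sequences are not
  complete, so boundedness alone would not give a representing vector.\<close>

lemma riesz_Rn:
  assumes D: "linear D" and D0: "\<And>h. (\<And>i. i < d \<Longrightarrow> coord h i = 0) \<Longrightarrow> D h = (0::real)"
  shows "D h = inner (vec d (\<lambda>i. D (unit i))) h"
proof -
  interpret linear D by (rule D)
  let ?k = "\<Sum>i<d. coord h i *\<^sub>R unit i"
  have "D (h - ?k) = 0"
    by (rule D0) (simp add: coord_sum of_bool_def if_distrib cong: if_cong)
  then have "D h = D ?k" by (simp add: diff)
  also have "\<dots> = (\<Sum>i<d. coord h i * D (unit i))"
    by (simp add: sum scale)
  also have "\<dots> = inner (vec d (\<lambda>i. D (unit i))) h"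
    by (simp add: inner_Rn[OF vec_mem_Rn] mult.commute)
  finally show ?thesis .
qed

definition joint_vec :: "nat \<Rightarrow> nat \<Rightarrow> (joint \<Rightarrow> real) \<Rightarrow> joint" where
  "joint_vec m n D = (vec m (\<lambda>i. D (unit i, 0)), vec n (\<lambda>j. D (0, unit j)))"

lemma joint_vec_mem [simp]: "joint_vec m n D \<in> Rn m \<times> Rn n"
  by (simp add: joint_vec_def)

lemma riesz_joint:
  assumes D: "linear D"
    and D0: "\<And>h. (\<And>i. i < m \<Longrightarrow> coord (fst h) i = 0) \<Longrightarrow> (\<And>j. j < n \<Longrightarrow> coord (snd h) j = 0)
                \<Longrightarrow> D h = (0::real)"
  shows "D h = inner (joint_vec m n D) h"
proof -
  interpret linear D by (rule D)
  have lin: "linear (\<lambda>x. D (x, 0))" "linear (\<lambda>y. D (0, y))"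
    using scale[of _ "(_, 0)"] scale[of _ "(0, _)"] add[of "(_, 0)" "(_, 0)"] add[of "(0, _)" "(0, _)"]
    by (simp_all add: linear_iff)
  have "D h = D (fst h, 0) + D (0, snd h)"
    by (simp add: add[symmetric])
  then show ?thesis
    using riesz_Rn[OF lin(1), of m "fst h"] riesz_Rn[OF lin(2), of n "snd h"] D0
    by (simp add: joint_vec_def inner_prod_def)
qed

text \<open>The line through \<open>v\<close> in direction \<open>G - G'\<close> stays inside
  \<open>E\<close>, and derivatives along a line are unique, so the difference has inner product 0
  with itself. This pins every oracle answer to the explicit gradient.\<close>

lemma has_grad_unique:
  assumes E: "subspace E" and v: "v \<in> E"
    and "has_grad E g G v E" and "has_grad E g G' v E"
  shows "G = G'"
proof -
  define h where "h = G - G'"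
  have h: "h \<in> E" using assms by (auto simp: h_def has_grad_def intro: subspace_diff)
  have *: "((\<lambda>t::real. g (v + t *\<^sub>R h)) has_derivative (\<lambda>t. inner K (t *\<^sub>R h))) (at 0)"
    if "has_grad E g K v E" for K
  proof -
    have c: "((\<lambda>t::real. v + t *\<^sub>R h) has_derivative (\<lambda>t. t *\<^sub>R h)) (at 0)"
      by (auto intro!: derivative_eq_intros)
    have "range (\<lambda>t::real. v + t *\<^sub>R h) \<subseteq> E"
      using E v h by (auto intro!: subspace_add subspace_scale)
    then have "(g has_derivative (\<lambda>h. inner K h))
        (at (v + 0 *\<^sub>R h) within range (\<lambda>t::real. v + t *\<^sub>R h))"
      using that by (auto simp: has_grad_def intro: has_derivative_subset)
    from has_derivative_in_compose[OF c this] show ?thesis by simp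
  qed
  have "(\<lambda>t::real. inner G (t *\<^sub>R h)) = (\<lambda>t. inner G' (t *\<^sub>R h))"
    by (rule has_derivative_unique) (use * assms in auto)
  from fun_cong[OF this, of 1] have "inner h h = 0"
    by (simp add: h_def inner_diff_left)
  then show ?thesis by (simp add: h_def)
qed

text \<open>Testing with a multiple of \<open>G v - G w\<close> of length
  \<open>norm (v - w)\<close> recovers the Lipschitz bound. The weak form is what termwise use of u
  v <= (u^2 + v^2)/2 produces.\<close>

lemma lipschitz_on_weak:
  fixes G :: "'a::real_inner \<Rightarrow> 'a"
  assumes "0 \<le> K" and "subspace E" and "\<And>v. v \<in> E \<Longrightarrow> G v \<in> E"
    and weak: "\<And>u v w. u \<in> E \<Longrightarrow> v \<in> E \<Longrightarrow> w \<in> E \<Longrightarrow>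
      inner (G v - G w) u \<le> K / 2 * ((norm u)\<^sup>2 + (norm (v - w))\<^sup>2)"
  shows "K-lipschitz_on E G"
proof (rule lipschitz_onI)
  fix v w assume vw: "v \<in> E" "w \<in> E"
  define d where "d = G v - G w"
  show "dist (G v) (G w) \<le> K * dist v w"
  proof (cases "d = 0")
    case False
    define u where "u = (norm (v - w) / norm d) *\<^sub>R d"
    have "u \<in> E" using assms vw by (auto simp: u_def d_def intro!: subspace_scale subspace_diff)
    moreover have "norm u = norm (v - w)" using False by (simp add: u_def)
    moreover have "inner d u = norm (v - w) * norm d"
      using False by (simp add: u_def dot_square_norm power2_eq_square)
    ultimately have "norm (v - w) * norm d \<le> norm (v - w) * (K * norm (v - w))"
      using weak[of u v w] vw by (simp add: d_def[symmetric] power2_eq_square algebra_simps)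
    then have "norm d \<le> K * norm (v - w) \<or> v = w"
      by (metis mult_le_cancel_left_pos norm_eq_zero norm_ge_zero order_less_le right_minus_eq)
    then show ?thesis using False by (auto simp: d_def dist_norm)
  qed (use assms(1) in \<open>simp add: d_def\<close>)
qed (fact assms(1))

section \<open>Scalar estimates\<close>

text \<open>The potential of the chain. For \<sigma> >= 0 its curvature is 1 left of 0, -1 up to
  \<sigma>/2 and 1 beyond, where it is the parabola with vertex at \<sigma> and value -\<sigma>^2/4.
  Squares of \<open>max\<close> glue the pieces differentiably.\<close>

definition bend :: "real \<Rightarrow> real \<Rightarrow> real" where
  "bend \<sigma> x = x\<^sup>2 / 2 - (max 0 x)\<^sup>2 + (max 0 (x - \<sigma> / 2))\<^sup>2"

definition bend' :: "real \<Rightarrow> real \<Rightarrow> real" where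
  "bend' \<sigma> x = x - 2 * max 0 x + 2 * max 0 (x - \<sigma> / 2)"

lemma max_sq_deriv:
  "((\<lambda>x::real. (max 0 x)\<^sup>2) has_real_derivative 2 * max 0 x) (at x)"
proof -
  have pos: "((\<lambda>x::real. (max 0 x)\<^sup>2) has_real_derivative 2 * max 0 x) (at x within {0..})"
    if "x \<ge> 0" for x
    unfolding has_field_derivative_def
    by (rule has_derivative_transform[where f = "\<lambda>x. x\<^sup>2"])
      (use that in \<open>auto intro!: derivative_eq_intros\<close>)
  have neg: "((\<lambda>x::real. (max 0 x)\<^sup>2) has_real_derivative 2 * max 0 x) (at x within {..0})"
    if "x \<le> 0" for x
    unfolding has_field_derivative_def
    by (rule has_derivative_transform[where f = "\<lambda>x. 0"])
      (use that in \<open>auto intro!: derivative_eq_intros\<close>)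
  consider "x > 0" | "x < 0" | "x = 0" by linarith
  then show ?thesis
  proof cases
    case 1
    then have "at x within {0..} = at x" by (intro at_within_interior) auto
    then show ?thesis using pos[of x] 1 by simp
  next
    case 2
    then have "at x within {..0} = at x" by (intro at_within_interior) auto
    then show ?thesis using neg[of x] 2 by simp
  next
    case 3
    have "{0..} \<union> {..0} = (UNIV :: real set)" by auto
    then have sup: "at (0::real) = sup (at 0 within {0..}) (at 0 within {..0})"
      by (simp add: at_within_union[symmetric])
    show ?thesis
      using pos[of 0] neg[of 0] unfolding 3 has_field_derivative_iff
      unfolding sup
      by (intro filterlim_sup) auto
  qed
qed

lemma bend_deriv: "(bend \<sigma> has_real_derivative bend' \<sigma> x) (at x)"
proof -
  have "((\<lambda>x. (max 0 (x - \<sigma> / 2))\<^sup>2) has_real_derivative 2 * max 0 (x - \<sigma> / 2)) (at x)"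
    by (rule DERIV_chain'[OF _ max_sq_deriv, where D = 1, simplified])
      (auto intro!: derivative_eq_intros)
  moreover have "((\<lambda>x. x\<^sup>2 / 2) has_real_derivative x) (at x)"
    by (auto intro!: derivative_eq_intros)
  ultimately show ?thesis
    unfolding bend_def[abs_def] bend'_def
    by (intro DERIV_add DERIV_diff max_sq_deriv)
qed

lemma bend'_lipschitz: "\<bar>bend' \<sigma> x - bend' \<sigma> y\<bar> \<le> \<bar>x - y\<bar>" if "0 \<le> \<sigma>"
  using that by (auto simp: bend'_def max_def split: if_splits)

text \<open>One formula for both signs, never positive: it makes the potential push the recursion
  down on either side of 0.\<close>

lemma bend'_eq: "x \<le> \<sigma> / 2 \<Longrightarrow> bend' \<sigma> x = - \<bar>x\<bar>"
  by (auto simp: bend'_def)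

lemma bend_0 [simp]: "0 \<le> \<sigma> \<Longrightarrow> bend \<sigma> 0 = 0" and bend'_0 [simp]: "0 \<le> \<sigma> \<Longrightarrow> bend' \<sigma> 0 = 0"
  by (auto simp: bend_def bend'_def)

lemma bend_self: "0 \<le> \<sigma> \<Longrightarrow> bend \<sigma> \<sigma> = - \<sigma>\<^sup>2 / 4"
  by (auto simp: bend_def power2_eq_square field_simps)

lemma bend_ge: "- \<sigma>\<^sup>2 / 4 \<le> bend \<sigma> x" if "0 \<le> \<sigma>"
proof -
  consider "x \<le> 0" | "0 \<le> x" "x \<le> \<sigma> / 2" | "x \<ge> \<sigma> / 2" "x \<ge> 0" by linarith
  then show ?thesis
  proof cases
    case 1
    then show ?thesis using that by (auto simp: bend_def max_def intro: order_trans[of _ 0])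
  next
    case 2
    then have "x\<^sup>2 \<le> (\<sigma> / 2)\<^sup>2" by (intro power_mono) auto
    then have "x\<^sup>2 \<le> \<sigma>\<^sup>2 / 4" by (simp add: power_divide)
    moreover have "bend \<sigma> x = - x\<^sup>2 / 2" using 2 by (simp add: bend_def max_def)
    moreover have "0 \<le> x\<^sup>2" by simp
    ultimately show ?thesis by linarith
  next
    case 3
    then have "bend \<sigma> x = (x - \<sigma>)\<^sup>2 / 2 - \<sigma>\<^sup>2 / 4"
      by (simp add: bend_def max_def power2_eq_square field_simps)
    then show ?thesis by simp
  qed
qed

text \<open>Read from the free end, the approximate stationarity equations are a second-order recursion.
  Below \<open>-c\<close> it can only descend, and otherwise its increments stay below \<open>3c\<close>, so it never
  reaches the source value \<open>\<sigma>\<close>.\<close>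

lemma recursion_below_source:
  fixes u :: "nat \<Rightarrow> real"
  assumes u0: "u 0 = 0" and c: "0 < c" "8 * c \<le> \<sigma>"
    and rec: "\<And>k. k < T \<Longrightarrow> \<bar>u (Suc k) - 2 * u k + u (k - 1) - bend' \<sigma> (u k)\<bar> \<le> c"
  shows "u T < \<sigma>"
proof -
  \<comment> \<open>At \<open>k = 0\<close> the truncated \<open>k - 1\<close> is again 0, so the
    free end is its own predecessor.\<close>
  have step: "u (Suc k) \<le> 2 * u k - u (k - 1) - \<bar>u k\<bar> + c" if "k < T" "u k \<le> \<sigma> / 2" for k
    using rec[OF that(1)] bend'_eq[OF that(2)] by linarith
  show ?thesis
  proof (cases "\<exists>k\<le>T. u k < - c")
    case True
    define k where "k = (LEAST k. u k < - c)"
    have k: "u k < - c" unfolding k_def using True by (auto intro: LeastI)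
    have "k \<le> T" unfolding k_def using True by (meson Least_le order_trans)
    have "k \<noteq> 0" using k u0 c by (metis less_minus_iff linorder_not_less minus_zero order_less_imp_le)
    then have "k - 1 < k" by simp
    then have "\<not> u (k - 1) < - c" unfolding k_def by (rule not_less_Least)
    then have start: "u k \<le> u (k - 1)" using k by linarith
    \<comment> \<open>Below \<open>-c\<close> the term \<open>- \<bar>u j\<bar> + c\<close> is
      negative, so a nonpositive increment is followed by a negative one.\<close>
    have "u j < - c \<and> u j \<le> u (j - 1)" if "k \<le> j" "j \<le> T" for j
      using that
    proof (induction j rule: dec_induct)
      case base
      show ?case using k start by simp
    next
      case (step j)
      then show ?case using assms(2,3) \<open>\<And>k. k < T \<Longrightarrow> u k \<le> \<sigma> / 2 \<Longrightarrow> _\<close>[of j] by auto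
    qed
    from this[OF \<open>k \<le> T\<close>] show ?thesis using c by auto
  next
    case False
    then have lower: "- c \<le> u k" if "k \<le> T" for k
      using that by (meson not_less)
    \<comment> \<open>For \<open>u k >= 0\<close> the absolute value cancels one copy of
      \<open>u k\<close>, and the next value is at most the increment plus \<open>c\<close>, hence
      at most \<open>4 * c\<close>. For \<open>u k < 0\<close> the lower bound on the predecessor
      gives \<open>2 * c\<close>. Since \<open>4 * c\<close> is at most \<sigma>/2,
      \<open>step\<close> stays applicable.\<close>
    have "u k - u (k - 1) \<le> 3 * c \<and> u k \<le> 4 * c" if "k \<le> T" for k
      using that
    proof (induction k)
      case 0
      then show ?case using u0 c by simp
    next
      case (Suc k)
      then have prev: "- c \<le> u (k - 1)" by (intro lower) simp
      from Suc show ?case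
        using step[of k] lower[of k] prev c
        by (cases "u k < 0") (simp_all add: abs_if)
    qed
    from this[of T] show ?thesis using c by auto
  qed
qed

text \<open>A discrete Poincare inequality: each value is the end value minus telescoped
  differences, Cauchy-Schwarz costs a factor \<open>n\<close>, and summing costs another. This n^2
  is what restricts the path length to the order of the square root of the condition number.\<close>

lemma path_poincare:
  fixes w :: "nat \<Rightarrow> real"
  assumes "0 \<le> \<mu>" "2 * (real n)\<^sup>2 * \<mu> \<le> b" "2 * real n * \<mu> \<le> \<theta>"
  shows "\<mu> * (\<Sum>k<n. (w k)\<^sup>2) \<le> b * (\<Sum>k<n-1. (w k - w (Suc k))\<^sup>2) + \<theta> * ((w 0)\<^sup>2 + (w (n-1))\<^sup>2)"
proof -
  define S where "S = (\<Sum>k<n-1. (w k - w (Suc k))\<^sup>2)"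
  have S0: "0 \<le> S" by (simp add: S_def sum_nonneg)
  have "(w k)\<^sup>2 \<le> 2 * (w 0)\<^sup>2 + 2 * real n * S" if "k < n" for k
  proof -
    have "(w 0 - w k)\<^sup>2 = (\<Sum>l<k. w l - w (Suc l))\<^sup>2"
      by (simp add: sum_lessThan_telescope')
    also have "\<dots> \<le> real k * (\<Sum>l<k. (w l - w (Suc l))\<^sup>2)"
      using sum_squared_le_sum_of_squares[of "\<lambda>l. w l - w (Suc l)" "{..<k}"] by (simp add: mult.commute)
    also have "\<dots> \<le> real n * S"
      unfolding S_def using that by (intro mult_mono sum_mono2) (auto intro: sum_nonneg)
    finally have "(w 0 - w k)\<^sup>2 \<le> real n * S" .
    moreover have "(w k)\<^sup>2 \<le> 2 * (w 0)\<^sup>2 + 2 * (w 0 - w k)\<^sup>2"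
      using zero_le_power2[of "2 * w 0 - w k"] by (simp add: power2_eq_square algebra_simps)
    ultimately show ?thesis by linarith
  qed
  then have "(\<Sum>k<n. (w k)\<^sup>2) \<le> (\<Sum>k<n. 2 * (w 0)\<^sup>2 + 2 * real n * S)"
    by (intro sum_mono) auto
  also have "\<dots> = 2 * real n * (w 0)\<^sup>2 + 2 * (real n)\<^sup>2 * S"
    by (simp add: power2_eq_square algebra_simps)
  finally have "\<mu> * (\<Sum>k<n. (w k)\<^sup>2) \<le> \<mu> * (2 * real n * (w 0)\<^sup>2 + 2 * (real n)\<^sup>2 * S)"
    using assms(1) by (rule mult_left_mono)
  also have "\<dots> = (2 * real n * \<mu>) * (w 0)\<^sup>2 + (2 * (real n)\<^sup>2 * \<mu>) * S"
    by (simp add: algebra_simps)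
  also have "\<dots> \<le> \<theta> * (w 0)\<^sup>2 + b * S"
    using assms S0 by (intro add_mono mult_right_mono) auto
  also have "\<dots> \<le> b * S + \<theta> * ((w 0)\<^sup>2 + (w (n-1))\<^sup>2)"
    using order_trans[OF _ assms(3), of 0] assms(1) by (simp add: distrib_left)
  finally show ?thesis by (simp add: S_def)
qed

section \<open>The chain objective\<close>

text \<open>Shifts the coordinates so that the source occupies index 0. Points use the source value
  \<sigma> and directions use 0, so differences and derivatives of nodes are nodes again.\<close>

definition node :: "real \<Rightarrow> rvec \<Rightarrow> nat \<Rightarrow> real" where
  "node c x i = (case i of 0 \<Rightarrow> c | Suc j \<Rightarrow> coord x j)"

lemma node_simps [simp]: "node c x 0 = c" "node c x (Suc j) = coord x j"
  by (simp_all add: node_def)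

lemma node_diff: "node c x i - node c x' i = node 0 (x - x') i"
  by (cases i) auto

lemma node_unit [simp]: "node 0 (unit j) i = of_bool (i = Suc j)"
  by (cases i) auto

lemma node_zero [simp]: "node 0 0 i = 0"
  by (cases i) auto

lemma has_derivative_node [derivative_intros]:
  "(g has_derivative g') F \<Longrightarrow> ((\<lambda>v. node c (g v) i) has_derivative (\<lambda>h. node 0 (g' h) i)) F"
  by (cases i) (auto intro!: derivative_eq_intros)

lemma has_derivative_bend [derivative_intros]:
  "(g has_derivative g') (at v within V) \<Longrightarrow>
    ((\<lambda>v. bend \<sigma> (g v)) has_derivative (\<lambda>h. bend' \<sigma> (g v) * g' h)) (at v within V)"
  using has_derivative_compose[of g g' v V "bend \<sigma>"] bend_deriv[of \<sigma> "g v"]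
  by (simp add: has_field_derivative_def)

locale chain =
  fixes T n :: nat and a b \<theta> e s \<sigma> :: real
  assumes T: "0 < T" and n: "0 < n" and \<theta>: "0 < \<theta>"
    and a: "0 \<le> a" and b: "0 \<le> b" and e: "0 \<le> e" and s: "0 \<le> s" and \<sigma>: "0 \<le> \<sigma>"
    and bn: "n = 1 \<or> 0 < b"
begin

text \<open>Resistance of the path: \<open>n - 1\<close> edges of resistance 1/b in series.\<close>

definition R :: real where "R = (real n - 1) / b"

definition C :: real where "C = a\<^sup>2 * R / (2 * (\<theta> * R + 2))"

text \<open>Stiffness of a link once its path has been maximized out, plus the direct
  coupling.\<close>

definition q :: real where "q = a\<^sup>2 / (\<theta> * (\<theta> * R + 2)) + e"

text \<open>Polarized, so that it serves as the negative Hessian form in y and, on the diagonal, as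
  the quadratic form. For \<open>n = 1\<close> both end terms fall on the same variable.\<close>

definition energy :: "(nat \<Rightarrow> real) \<Rightarrow> (nat \<Rightarrow> real) \<Rightarrow> nat \<Rightarrow> real" where
  "energy y w i =
     b * (\<Sum>k<n-1. (y (i*n + k) - y (i*n + Suc k)) * (w (i*n + k) - w (i*n + Suc k)))
     + \<theta> * (y (i*n) * w (i*n) + y (i*n + (n-1)) * w (i*n + (n-1)))"

text \<open>The maximum over a path would also leave a multiple of $(z_i + z_{i+1})^2$. A correction by
  this term itself would couple neighbouring nodes directly and break the zero chain, so \<open>C\<close>
  multiplies $z_i^2 + z_{i+1}^2$, which turns the excess into a multiple of $(z_i - z_{i+1})^2$.\<close>

definition link :: "(nat \<Rightarrow> real) \<Rightarrow> (nat \<Rightarrow> real) \<Rightarrow> nat \<Rightarrow> real" where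
  "link z y i = a * (z i * y (i*n) - z (Suc i) * y (i*n + (n-1))) - energy y y i / 2
     - C * ((z i)\<^sup>2 + (z (Suc i))\<^sup>2) + e/2 * (z i - z (Suc i))\<^sup>2 + s * bend \<sigma> (z (Suc i))"

definition dlink ::
    "(nat \<Rightarrow> real) \<Rightarrow> (nat \<Rightarrow> real) \<Rightarrow> (nat \<Rightarrow> real) \<Rightarrow> (nat \<Rightarrow> real) \<Rightarrow> nat \<Rightarrow> real" where
  "dlink z y p w i =
     a * (p i * y (i*n) + z i * w (i*n)
          - p (Suc i) * y (i*n + (n-1)) - z (Suc i) * w (i*n + (n-1)))
     - energy y w i
     - 2 * C * (z i * p i + z (Suc i) * p (Suc i))
     + e * ((z i - z (Suc i)) * (p i - p (Suc i)))
     + s * (bend' \<sigma> (z (Suc i)) * p (Suc i))"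

definition obj :: "joint \<Rightarrow> real" where
  "obj v = (\<Sum>i<T. link (node \<sigma> (fst v)) (coord (snd v)) i)"

definition dobj :: "joint \<Rightarrow> joint \<Rightarrow> real" where
  "dobj v h = (\<Sum>i<T. dlink (node \<sigma> (fst v)) (coord (snd v)) (node 0 (fst h)) (coord (snd h)) i)"

definition reduced :: "rvec \<Rightarrow> real" where
  "reduced x = (\<Sum>i<T. q/2 * (node \<sigma> x i - node \<sigma> x (Suc i))\<^sup>2 + s * bend \<sigma> (node \<sigma> x (Suc i)))"

definition dreduced :: "rvec \<Rightarrow> rvec \<Rightarrow> real" where
  "dreduced x h = (\<Sum>i<T. q * ((node \<sigma> x i - node \<sigma> x (Suc i)) * (node 0 h i - node 0 h (Suc i)))
     + s * (bend' \<sigma> (node \<sigma> x (Suc i)) * node 0 h (Suc i)))"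

lemma R_nonneg: "0 \<le> R"
  using n b by (simp add: R_def)

lemma denom_pos: "0 < \<theta> * R + 2"
  using R_nonneg \<theta> by (simp add: add_nonneg_pos)

lemma C_nonneg: "0 \<le> C"
  using R_nonneg denom_pos by (simp add: C_def)

lemma q_nonneg: "0 \<le> q"
  using denom_pos \<theta> e by (simp add: q_def)

section \<open>Derivatives and gradient of the objective\<close>

lemma energy_deriv:
  "((\<lambda>v::joint. energy (coord (snd v)) (coord (snd v)) i) has_derivative
     (\<lambda>h. 2 * energy (coord (snd v)) (coord (snd h)) i)) (at v within V)"
  unfolding energy_def
  by (auto intro!: derivative_eq_intros sum.cong ext simp: sum_distrib_left algebra_simps)

lemma link_deriv:
  "((\<lambda>v. link (node \<sigma> (fst v)) (coord (snd v)) i) has_derivative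
     (\<lambda>h. dlink (node \<sigma> (fst v)) (coord (snd v)) (node 0 (fst h)) (coord (snd h)) i))
   (at v within V)"
  unfolding link_def dlink_def
  by (auto intro!: derivative_eq_intros energy_deriv ext
      simp: field_simps power2_eq_square simp del: node_simps)

lemma obj_deriv: "(obj has_derivative dobj v) (at v within V)"
  unfolding obj_def[abs_def] dobj_def[abs_def] by (intro has_derivative_sum link_deriv)

lemma reduced_deriv: "(reduced has_derivative dreduced x) (at x within V)"
  unfolding reduced_def[abs_def] dreduced_def[abs_def]
  by (auto intro!: derivative_eq_intros sum.cong ext simp: field_simps power2_eq_square simp del: node_simps)

lemma sum_blocks: "(\<Sum>j<T*n. g j) = (\<Sum>i<T. \<Sum>k<n. g (i*n + k))" for g :: "nat \<Rightarrow> real"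
proof -
  have "(\<Sum>k<n. g (i*n + k)) = sum g {i*n..<i*n+n}" for i
    by (rule sum.reindex_bij_witness[where i = "\<lambda>j. j - i*n" and j = "\<lambda>k. i*n + k"]) auto
  then show ?thesis
    using sum.nat_group[of g n T] by simp
qed

definition grad :: "joint \<Rightarrow> joint" where
  "grad v = joint_vec T (T*n) (dobj v)"

lemma block_index: "i*n + k < T*n" if "i < T" "k < n"
proof -
  have "i*n + k < Suc i * n" using that by simp
  also have "\<dots> \<le> T * n" using that by (intro mult_le_mono1) simp
  finally show ?thesis .
qed

lemma inner_grad: "inner (grad v) h = dobj v h"
proof -
  have "dobj v h = 0" if "\<And>i. i < T \<Longrightarrow> coord (fst h) i = 0" "\<And>j. j < T * n \<Longrightarrow> coord (snd h) j = 0" for h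
    unfolding dobj_def
  proof (rule sum.neutral, safe)
    fix i assume "i < T"
    then have "node 0 (fst h) i = 0" "coord (fst h) i = 0" using that by (auto simp: node_def split: nat.split)
    moreover have "coord (snd h) (i*n + k) = 0" if "k < n" for k
      using block_index[OF \<open>i < T\<close> that] \<open>\<And>j. j < T * n \<Longrightarrow> _\<close> by blast
    from this[of 0] this[of "n-1"] this n
    have "coord (snd h) (i*n) = 0" "coord (snd h) (i*n + (n-1)) = 0"
      "\<And>k. k < n - 1 \<Longrightarrow> coord (snd h) (i*n + k) = 0 \<and> coord (snd h) (i*n + Suc k) = 0"
      by (auto simp del: add_Suc_right)
    ultimately show "dlink (node \<sigma> (fst v)) (coord (snd v)) (node 0 (fst h)) (coord (snd h)) i = 0"
      by (simp add: dlink_def energy_def)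
  qed
  then show ?thesis
    unfolding grad_def
    by (intro riesz_joint[OF has_derivative_linear[OF obj_deriv], symmetric]) blast
qed

lemma has_grad_obj: "has_grad (Rn T \<times> Rn (T*n)) obj (grad v) v V"
  unfolding has_grad_def inner_grad
  using obj_deriv by (simp add: grad_def)

text \<open>The objective is quadratic in y, so its second-order expansion is exact. It gives both
  strong concavity and optimality of the response.\<close>

lemma obj_diff_snd:
  "obj (x, y) = obj (x, y') + dobj (x, y') (0, y - y')
     - (\<Sum>i<T. energy (coord (y - y')) (coord (y - y')) i) / 2"
proof -
  have en: "energy (coord y) (coord y) i
      = energy (coord y') (coord y') i + 2 * energy (coord y') (coord (y - y')) i
        + energy (coord (y - y')) (coord (y - y')) i" for i
    unfolding energy_def
    by (simp add: sum_distrib_left sum.distrib[symmetric] distrib_left sum_subtractf[symmetric]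
        algebra_simps)
  have "link z (coord y) i = link z (coord y') i + dlink z (coord y') (node 0 0) (coord (y - y')) i
      - energy (coord (y - y')) (coord (y - y')) i / 2" for z i
    unfolding link_def dlink_def en by (simp add: algebra_simps add_divide_distrib)
  then show ?thesis
    by (simp add: obj_def dobj_def sum.distrib sum_subtractf sum_divide_distrib)
qed

section \<open>Closed form of the maximum over the path variables\<close>

definition current :: "rvec \<Rightarrow> nat \<Rightarrow> real" where
  "current x i = a * (node \<sigma> x i + node \<sigma> x (Suc i)) / (\<theta> * R + 2)"

text \<open>Stationarity fixes the sum of the two end values,
  \<open>a * (node \<sigma> x i - node \<sigma> x (Suc i)) / \<theta>\<close>, and their difference,
  \<open>current x i * R\<close>. This determines the first value; every edge then lowers it by
  \<open>current x i / b\<close>.\<close>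

definition response :: "rvec \<Rightarrow> rvec" where
  "response x = vec (T*n) (\<lambda>j. let i = j div n in
     (a * (node \<sigma> x i - node \<sigma> x (Suc i)) / \<theta> + current x i * R) / 2
       - real (j mod n) * (current x i / b))"

lemma coord_response:
  assumes "i < T" "k < n"
  shows "coord (response x) (i*n + k)
    = (a * (node \<sigma> x i - node \<sigma> x (Suc i)) / \<theta> + current x i * R) / 2 - real k * (current x i / b)"
proof -
  have "(i*n + k) div n = i" "(i*n + k) mod n = k" using assms by auto
  then show ?thesis using block_index[OF assms] by (simp add: response_def Let_def)
qed

text \<open>The block is a resistor path with conductances \<open>b\<close> whose two ends are grounded through
  \<open>\<theta>\<close>. Driven at its ends it carries a constant current, so the response is affine.\<close>

lemma response_energy:
  assumes "i < T"
  shows "energy (coord (response x)) w i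
    = a * (node \<sigma> x i * w (i*n) - node \<sigma> x (Suc i) * w (i*n + (n-1)))"
proof -
  let ?p = "node \<sigma> x i" and ?p' = "node \<sigma> x (Suc i)" and ?y = "coord (response x)"
  define j where "j = current x i"
  have j: "j * (\<theta> * R + 2) = a * (?p + ?p')"
    using denom_pos by (simp add: j_def current_def)
  have first: "?y (i*n) = (a * (?p - ?p') / \<theta> + j * R) / 2"
    using coord_response[OF assms, of 0] n by (simp add: j_def)
  have last: "?y (i*n + (n-1)) = (a * (?p - ?p') / \<theta> - j * R) / 2"
    using coord_response[OF assms, of "n-1" x] n by (simp add: j_def R_def of_nat_diff field_simps)
  have "b * (\<Sum>k<n-1. (?y (i*n + k) - ?y (i*n + Suc k)) * (w (i*n + k) - w (i*n + Suc k)))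
      = (\<Sum>k<n-1. j * (w (i*n + k) - w (i*n + Suc k)))"
    unfolding sum_distrib_left
  proof (rule sum.cong[OF refl])
    fix k assume k: "k \<in> {..<n-1}"
    \<comment> \<open>An edge exists only for \<open>n > 1\<close>, where \<open>bn\<close> makes
      \<open>b\<close> positive.\<close>
    with bn have "b \<noteq> 0" and k': "k < n" "Suc k < n" by auto
    moreover have "?y (i*n + k) - ?y (i*n + Suc k) = j / b"
      using coord_response[OF assms k'(1), of x] coord_response[OF assms k'(2), of x]
      by (simp add: j_def algebra_simps add_divide_distrib diff_divide_distrib del: add_Suc_right)
    ultimately show "b * ((?y (i*n + k) - ?y (i*n + Suc k)) * (w (i*n + k) - w (i*n + Suc k)))
        = j * (w (i*n + k) - w (i*n + Suc k))" by simp
  qed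
  also have "\<dots> = j * (w (i*n) - w (i*n + (n-1)))"
    using sum_lessThan_telescope'[of "\<lambda>k. w (i*n + k)" "n-1"] by (simp add: sum_distrib_left[symmetric])
  finally have "2 * energy ?y w i
      = 2 * j * (w (i*n) - w (i*n + (n-1)))
        + 2 * \<theta> * ((a * (?p - ?p') / \<theta> + j * R) / 2 * w (i*n)
                 + (a * (?p - ?p') / \<theta> - j * R) / 2 * w (i*n + (n-1)))"
    unfolding energy_def first last by (simp add: algebra_simps)
  also have "\<dots> = (a * (?p - ?p') + j * (\<theta> * R + 2)) * w (i*n)
      + (a * (?p - ?p') - j * (\<theta> * R + 2)) * w (i*n + (n-1))"
    using \<theta> by (simp add: field_simps)
  also have "\<dots> = 2 * (a * (?p * w (i*n) - ?p' * w (i*n + (n-1))))"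
    unfolding j by (simp add: algebra_simps)
  finally show ?thesis by simp
qed

text \<open>By \<open>response_energy\<close> applied to the response itself, the energy equals the
  drive, so half of the drive remains. It contains a multiple \<open>C\<close> of (z_i + z_{i+1})^2,
  which the correction in \<open>link\<close> turns into a multiple of (z_i - z_{i+1})^2; the
  identity \<open>a\<^sup>2 / (2 * \<theta>) - C = q - e\<close> gives the stiffness.\<close>

lemma obj_response: "obj (x, response x) = reduced x"
  unfolding obj_def reduced_def
proof (intro sum.cong refl)
  fix i assume "i \<in> {..<T}"
  then have i: "i < T" by simp
  let ?p = "node \<sigma> x i" and ?p' = "node \<sigma> x (Suc i)" and ?y = "coord (response x)"
  define j where "j = current x i"
  have first: "?y (i*n) = (a * (?p - ?p') / \<theta> + j * R) / 2"
    using coord_response[OF i, of 0] n by (simp add: j_def)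
  have last: "?y (i*n + (n-1)) = (a * (?p - ?p') / \<theta> - j * R) / 2"
    using coord_response[OF i, of "n-1" x] n by (simp add: j_def R_def of_nat_diff field_simps)
  have "a * (?p * ?y (i*n) - ?p' * ?y (i*n + (n-1)))
      = a\<^sup>2 * (?p - ?p')\<^sup>2 / (2 * \<theta>) + a * R / 2 * j * (?p + ?p')"
    unfolding first last using \<theta> by (simp add: field_simps power2_eq_square)
  also have "\<dots> = a\<^sup>2 * (?p - ?p')\<^sup>2 / (2 * \<theta>) + C * (?p + ?p')\<^sup>2"
    using denom_pos by (simp add: C_def j_def current_def field_simps power2_eq_square)
  finally have drive: "a * (?p * ?y (i*n) - ?p' * ?y (i*n + (n-1)))
      = a\<^sup>2 * (?p - ?p')\<^sup>2 / (2 * \<theta>) + C * (?p + ?p')\<^sup>2" .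
  have "a\<^sup>2 / (2 * \<theta>) - C = a\<^sup>2 / (\<theta> * (\<theta> * R + 2))"
  proof -
    define d where "d = \<theta> * R + 2"
    have "R = (d - 2) / \<theta>" "0 < d" using \<theta> denom_pos by (auto simp: d_def)
    then have C_eq: "C = a\<^sup>2 * ((d - 2) / \<theta>) / (2 * d)"
      unfolding C_def d_def[symmetric] by simp
    show ?thesis
      unfolding d_def[symmetric] C_eq using \<theta> \<open>0 < d\<close> by (simp add: field_simps)
  qed
  then have q_eq: "a\<^sup>2 / (2 * \<theta>) = q - e + C" by (simp add: q_def)
  have "link (node \<sigma> x) ?y i = (a\<^sup>2 / (2 * \<theta>) * (?p - ?p')\<^sup>2 + C * (?p + ?p')\<^sup>2) / 2
      - C * (?p\<^sup>2 + ?p'\<^sup>2) + e/2 * (?p - ?p')\<^sup>2 + s * bend \<sigma> ?p'"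
    unfolding link_def response_energy[OF i] drive by simp
  also have "\<dots> = q/2 * (?p - ?p')\<^sup>2 + s * bend \<sigma> ?p'"
    unfolding q_eq by (simp add: power2_eq_square field_simps)
  finally show "link (node \<sigma> (fst (x, response x))) (coord (snd (x, response x))) i
      = q/2 * (?p - ?p')\<^sup>2 + s * bend \<sigma> ?p'" by simp
qed

lemma energy_nonneg: "0 \<le> energy w w i"
  unfolding energy_def
  by (intro add_nonneg_nonneg mult_nonneg_nonneg[OF b] mult_nonneg_nonneg[OF less_imp_le[OF \<theta>]]
      sum_nonneg zero_le_square)

text \<open>The y-derivative vanishes at the response by \<open>response_energy\<close>, so the
  exact expansion around it only subtracts a nonnegative energy.\<close>

lemma max_fun_obj: "max_fun obj (Rn (T*n)) x = reduced x"
  unfolding max_fun_def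
proof (rule Greatest_equality)
  show "reduced x \<in> (\<lambda>y. obj (x, y)) ` Rn (T*n)"
    using obj_response[of x, symmetric] by (rule image_eqI) (simp add: response_def)
next
  fix z assume "z \<in> (\<lambda>y. obj (x, y)) ` Rn (T*n)"
  then obtain y where z: "z = obj (x, y)" by auto
  have "dlink (node \<sigma> x) (coord (response x)) (node 0 0) w i = 0" if "i < T" for w i
    using response_energy[OF that, of x w] by (simp add: dlink_def algebra_simps)
  then have "dobj (x, response x) (0, y - response x) = 0"
    by (simp add: dobj_def)
  then show "z \<le> reduced x"
    using obj_diff_snd[of x y "response x"]
    by (simp add: z obj_response sum_nonneg energy_nonneg)
qed

subsection \<open>Smoothness and membership in the class\<close>

lemma sum_nodes_le: "(\<Sum>i<T. (node 0 x i)\<^sup>2) \<le> (\<Sum>i<T. (coord x i)\<^sup>2)"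
proof -
  have "(\<Sum>i<T. (node 0 x i)\<^sup>2) \<le> (\<Sum>i<Suc T. (node 0 x i)\<^sup>2)" by simp
  also have "\<dots> = (\<Sum>i<T. (coord x i)\<^sup>2)"
    by (subst sum.lessThan_Suc_shift) simp
  finally show ?thesis .
qed

definition block :: "(nat \<Rightarrow> real) \<Rightarrow> nat \<Rightarrow> real" where
  "block w i = (\<Sum>k<n. (w (i*n + k))\<^sup>2)"

lemma block_ends: "(w (i*n))\<^sup>2 \<le> block w i" "(w (i*n + (n-1)))\<^sup>2 \<le> block w i"
  unfolding block_def
  using member_le_sum[of 0 "{..<n}" "\<lambda>k. (w (i*n + k))\<^sup>2"]
    member_le_sum[of "n-1" "{..<n}" "\<lambda>k. (w (i*n + k))\<^sup>2"] n
  by auto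

lemma block_diffs: "(\<Sum>k<n-1. (w (i*n + k) - w (i*n + Suc k))\<^sup>2) \<le> 4 * block w i"
proof -
  obtain m where m: "n = Suc m" using n by (cases n) auto
  have "(\<Sum>k<m. (w (i*n + k) - w (i*n + Suc k))\<^sup>2)
      \<le> (\<Sum>k<m. 2 * (w (i*n + k))\<^sup>2 + 2 * (w (i*n + Suc k))\<^sup>2)"
  proof (rule sum_mono)
    fix k
    show "(w (i*n + k) - w (i*n + Suc k))\<^sup>2 \<le> 2 * (w (i*n + k))\<^sup>2 + 2 * (w (i*n + Suc k))\<^sup>2"
      using zero_le_power2[of "w (i*n + k) + w (i*n + Suc k)"]
      by (simp add: power2_eq_square algebra_simps)
  qed
  also have "\<dots> = 2 * (\<Sum>k<m. (w (i*n + k))\<^sup>2) + 2 * (\<Sum>k<m. (w (i*n + Suc k))\<^sup>2)"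
    by (simp add: sum.distrib sum_distrib_left)
  also have "(\<Sum>k<m. (w (i*n + k))\<^sup>2) \<le> block w i"
    unfolding block_def unfolding m by (rule sum_mono2) auto
  also have "(\<Sum>k<m. (w (i*n + Suc k))\<^sup>2) \<le> block w i"
    unfolding block_def unfolding m sum.lessThan_Suc_shift[of _ m] by simp
  finally show ?thesis by (simp add: m)
qed

lemma sum_block: "y \<in> Rn (T*n) \<Longrightarrow> (\<Sum>i<T. block (coord y) i) = (norm y)\<^sup>2"
  by (simp add: block_def norm_Rn sum_blocks)

lemma mult_le_squares: "u * v \<le> (u\<^sup>2 + v\<^sup>2) / 2" for u v :: real
  using sum_squares_bound[of u v] by simp

lemma neg_mult_le_squares: "- (u * v) \<le> (u\<^sup>2 + v\<^sup>2) / 2" for u v :: real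
  using mult_le_squares[of "-u" v] by simp

lemma energy_bound: "- energy y w i \<le> (2 * b + \<theta>) * (block y i + block w i)"
proof -
  have "- (\<Sum>k<n-1. (y (i*n + k) - y (i*n + Suc k)) * (w (i*n + k) - w (i*n + Suc k)))
      \<le> (\<Sum>k<n-1. ((y (i*n + k) - y (i*n + Suc k))\<^sup>2 + (w (i*n + k) - w (i*n + Suc k))\<^sup>2) / 2)"
    unfolding sum_negf[symmetric] by (intro sum_mono neg_mult_le_squares)
  also have "\<dots> = ((\<Sum>k<n-1. (y (i*n + k) - y (i*n + Suc k))\<^sup>2)
      + (\<Sum>k<n-1. (w (i*n + k) - w (i*n + Suc k))\<^sup>2)) / 2"
    by (simp add: sum_divide_distrib[symmetric] sum.distrib)
  also have "\<dots> \<le> 2 * (block y i + block w i)"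
    using block_diffs[of y i] block_diffs[of w i] by simp
  finally have "b * - (\<Sum>k<n-1. (y (i*n + k) - y (i*n + Suc k)) * (w (i*n + k) - w (i*n + Suc k)))
      \<le> b * (2 * (block y i + block w i))"
    using b by (rule mult_left_mono)
  moreover have "\<theta> * - (y (i*n) * w (i*n) + y (i*n + (n-1)) * w (i*n + (n-1)))
      \<le> \<theta> * (block y i + block w i)"
    using \<theta> neg_mult_le_squares[of "y (i*n)" "w (i*n)"] block_ends[of y i] block_ends[of w i]
      neg_mult_le_squares[of "y (i*n + (n-1))" "w (i*n + (n-1))"]
    by (intro mult_left_mono) (auto simp del: One_nat_def)
  ultimately show ?thesis by (simp add: energy_def algebra_simps)
qed

text \<open>By linearity in the direction, the difference consists of products of a point increment
  with a direction entry, each split into squares; the potential enters through its 1-Lipschitz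
  slope. Node terms and path terms stay separate so that each block gets its own smoothness
  budget.\<close>

lemma dlink_lipschitz:
  "dlink z y p w i - dlink z' y' p w i
    \<le> (a/2 + C + e) * ((z i - z' i)\<^sup>2 + (z (Suc i) - z' (Suc i))\<^sup>2 + (p i)\<^sup>2 + (p (Suc i))\<^sup>2)
      + s/2 * ((z (Suc i) - z' (Suc i))\<^sup>2 + (p (Suc i))\<^sup>2)
      + (a + 2 * b + \<theta>) * (block (\<lambda>j. y j - y' j) i + block w i)"
proof -
  define d where "d = (\<lambda>j. y j - y' j)"
  define r r' where "r = z i - z' i" and "r' = z (Suc i) - z' (Suc i)"
  let ?m = "i*n + (n-1)" and ?B = "block d i + block w i"
  have energy: "energy y w i - energy y' w i = energy d w i"
    unfolding energy_def d_def by (simp add: sum_subtractf sum.distrib algebra_simps)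
  have "dlink z y p w i - dlink z' y' p w i =
      a * (p i * d (i*n) + r * w (i*n) - p (Suc i) * d ?m - r' * w ?m)
      - energy d w i - 2 * C * (r * p i + r' * p (Suc i)) + e * ((r - r') * (p i - p (Suc i)))
      + s * ((bend' \<sigma> (z (Suc i)) - bend' \<sigma> (z' (Suc i))) * p (Suc i))"
    unfolding dlink_def energy[symmetric] by (simp add: d_def r_def r'_def algebra_simps)
  moreover have "a * (p i * d (i*n) + r * w (i*n) - p (Suc i) * d ?m - r' * w ?m)
      \<le> a * ((r\<^sup>2 + r'\<^sup>2 + (p i)\<^sup>2 + (p (Suc i))\<^sup>2) / 2 + ?B)"
    using mult_le_squares[of "p i" "d (i*n)"] mult_le_squares[of r "w (i*n)"]
      neg_mult_le_squares[of "p (Suc i)" "d ?m"] neg_mult_le_squares[of r' "w ?m"]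
      block_ends[of d i] block_ends[of w i]
    by (intro mult_left_mono[OF _ a]) argo
  moreover have "- energy d w i \<le> (2 * b + \<theta>) * ?B"
    by (rule energy_bound)
  moreover have "- (2 * C * (r * p i + r' * p (Suc i)))
      \<le> C * (r\<^sup>2 + r'\<^sup>2 + (p i)\<^sup>2 + (p (Suc i))\<^sup>2)"
    using mult_left_mono[OF add_mono[OF neg_mult_le_squares[of r "p i"]
          neg_mult_le_squares[of r' "p (Suc i)"]], of "2 * C"] C_nonneg
    by (simp add: algebra_simps add_divide_distrib)
  moreover have "e * ((r - r') * (p i - p (Suc i)))
      \<le> e * (r\<^sup>2 + r'\<^sup>2 + (p i)\<^sup>2 + (p (Suc i))\<^sup>2)"
  proof (rule mult_left_mono[OF _ e])
    have "(u - v)\<^sup>2 \<le> 2 * (u\<^sup>2 + v\<^sup>2)" for u v :: real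
      using zero_le_power2[of "u + v"] by (simp add: power2_eq_square algebra_simps)
    from this[of r r'] this[of "p i" "p (Suc i)"] mult_le_squares[of "r - r'" "p i - p (Suc i)"]
    show "(r - r') * (p i - p (Suc i)) \<le> r\<^sup>2 + r'\<^sup>2 + (p i)\<^sup>2 + (p (Suc i))\<^sup>2" by argo
  qed
  moreover have "s * ((bend' \<sigma> (z (Suc i)) - bend' \<sigma> (z' (Suc i))) * p (Suc i))
      \<le> s * ((r'\<^sup>2 + (p (Suc i))\<^sup>2) / 2)"
  proof (rule mult_left_mono[OF _ s])
    let ?g = "bend' \<sigma> (z (Suc i)) - bend' \<sigma> (z' (Suc i))"
    have "?g\<^sup>2 \<le> r'\<^sup>2"
      using bend'_lipschitz[OF \<sigma>] by (simp add: r'_def abs_le_square_iff[symmetric])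
    then show "?g * p (Suc i) \<le> (r'\<^sup>2 + (p (Suc i))\<^sup>2) / 2"
      using mult_le_squares[of ?g "p (Suc i)"] by argo
  qed
  ultimately show ?thesis
    unfolding d_def[symmetric] r_def[symmetric] r'_def[symmetric]
    by (simp add: algebra_simps add_divide_distrib)
qed

text \<open>A node lies in at most two links, so summation at most doubles the node terms, while the
  paths are disjoint.\<close>

lemma grad_lipschitz:
  assumes K1: "2 * a + 4 * C + 4 * e + s \<le> K" and K2: "2 * a + 4 * b + 2 * \<theta> \<le> K"
  shows "K-lipschitz_on (Rn T \<times> Rn (T*n)) grad"
proof (rule lipschitz_on_weak)
  show "0 \<le> K" using K1 a C_nonneg e s by linarith
  show "subspace (Rn T \<times> Rn (T*n))" by (simp add: subspace_Times subspace_Rn)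
  show "grad v \<in> Rn T \<times> Rn (T*n)" for v by (simp add: grad_def)
  fix u v w assume uvw: "u \<in> Rn T \<times> Rn (T*n)" "v \<in> Rn T \<times> Rn (T*n)" "w \<in> Rn T \<times> Rn (T*n)"
  define X where "X x = (\<Sum>i<T. (coord x i)\<^sup>2)" for x
  have X: "X (fst u) = (norm (fst u))\<^sup>2" "X (fst v - fst w) = (norm (fst v - fst w))\<^sup>2"
    unfolding X_def using uvw
    by (auto simp del: coord_simps intro!: norm_Rn[symmetric] subspace_diff[OF subspace_Rn])
  have Y: "(\<Sum>i<T. block (coord (snd u)) i) = (norm (snd u))\<^sup>2"
    "(\<Sum>i<T. block (coord (snd v - snd w)) i) = (norm (snd v - snd w))\<^sup>2"
    using uvw by (auto intro!: sum_block subspace_diff[OF subspace_Rn])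
  let ?d = "fst v - fst w" and ?c = "snd v - snd w"
  have "inner (grad v - grad w) u = dobj v u - dobj w u"
    by (simp add: inner_diff_left inner_grad)
  also have "\<dots> \<le> (\<Sum>i<T.
      (a/2 + C + e) * ((node 0 ?d i)\<^sup>2 + (coord ?d i)\<^sup>2 + (node 0 (fst u) i)\<^sup>2 + (coord (fst u) i)\<^sup>2)
      + s/2 * ((coord ?d i)\<^sup>2 + (coord (fst u) i)\<^sup>2)
      + (a + 2 * b + \<theta>) * (block (coord ?c) i + block (coord (snd u)) i))"
    unfolding dobj_def sum_subtractf[symmetric]
  proof (rule sum_mono)
    fix i
    have "(\<lambda>j. coord (snd v) j - coord (snd w) j) = coord ?c" by auto
    then show "dlink (node \<sigma> (fst v)) (coord (snd v)) (node 0 (fst u)) (coord (snd u)) i -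
        dlink (node \<sigma> (fst w)) (coord (snd w)) (node 0 (fst u)) (coord (snd u)) i
      \<le> (a/2 + C + e) * ((node 0 ?d i)\<^sup>2 + (coord ?d i)\<^sup>2 + (node 0 (fst u) i)\<^sup>2 + (coord (fst u) i)\<^sup>2)
      + s/2 * ((coord ?d i)\<^sup>2 + (coord (fst u) i)\<^sup>2)
      + (a + 2 * b + \<theta>) * (block (coord ?c) i + block (coord (snd u)) i)"
      using dlink_lipschitz[of "node \<sigma> (fst v)" "coord (snd v)" "node 0 (fst u)" "coord (snd u)" i
          "node \<sigma> (fst w)" "coord (snd w)"]
      by (simp add: node_diff)
  qed
  also have "\<dots> = (a/2 + C + e) * ((\<Sum>i<T. (node 0 ?d i)\<^sup>2) + X ?d + (\<Sum>i<T. (node 0 (fst u) i)\<^sup>2) + X (fst u))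
      + s/2 * (X ?d + X (fst u)) + (a + 2 * b + \<theta>) * ((norm ?c)\<^sup>2 + (norm (snd u))\<^sup>2)"
    by (simp add: X_def Y[symmetric] sum.distrib sum_distrib_left distrib_left)
  also have "\<dots> \<le> (a/2 + C + e) * (X ?d + X ?d + X (fst u) + X (fst u))
      + s/2 * (X ?d + X (fst u)) + (a + 2 * b + \<theta>) * ((norm ?c)\<^sup>2 + (norm (snd u))\<^sup>2)"
    unfolding X_def using a C_nonneg e
    by (intro add_mono mult_left_mono order_refl sum_nodes_le) auto
  also have "\<dots> = (2 * a + 4 * C + 4 * e + s) / 2 * ((norm ?d)\<^sup>2 + (norm (fst u))\<^sup>2)
      + (2 * a + 4 * b + 2 * \<theta>) / 2 * ((norm ?c)\<^sup>2 + (norm (snd u))\<^sup>2)"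
    unfolding X by (simp add: algebra_simps add_divide_distrib)
  also have "\<dots> \<le> K / 2 * ((norm ?d)\<^sup>2 + (norm (fst u))\<^sup>2) + K / 2 * ((norm ?c)\<^sup>2 + (norm (snd u))\<^sup>2)"
    using K1 K2 by (intro add_mono mult_right_mono) auto
  also have "\<dots> = K / 2 * ((norm u)\<^sup>2 + (norm (v - w))\<^sup>2)"
    by (simp add: norm_prod_def algebra_simps)
  finally show "inner (grad v - grad w) u \<le> K / 2 * ((norm u)\<^sup>2 + (norm (v - w))\<^sup>2)" .
qed

text \<open>At the origin only the first link, between the source and the first node, is
  stretched.\<close>

lemma reduced_0: "reduced 0 = q / 2 * \<sigma>\<^sup>2"
proof -
  have "reduced 0 = (\<Sum>i<T. if i = 0 then q / 2 * \<sigma>\<^sup>2 else 0)"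
    unfolding reduced_def using \<sigma> by (intro sum.cong) (auto simp: node_def split: nat.split)
  then show ?thesis using T by simp
qed

lemma obj_mem_fun_class:
  assumes K1: "2 * a + 4 * C + 4 * e + s \<le> L" and K2: "2 * a + 4 * b + 2 * \<theta> \<le> L"
    and coercive: "\<And>w i. \<mu> * block w i \<le> energy w w i"
    and gap: "q / 2 * \<sigma>\<^sup>2 + real T * s * \<sigma>\<^sup>2 / 4 \<le> \<Delta>"
  shows "obj \<in> fun_class L \<mu> \<Delta> T (T*n) (Rn T) (Rn (T*n))"
proof -
  have concave: "obj (x, y1) \<le> obj (x, y2) + inner (snd (grad (x, y2))) (y1 - y2)
      - 1/2 * \<mu> * (norm (y1 - y2))\<^sup>2" if "y1 \<in> Rn (T*n)" "y2 \<in> Rn (T*n)" for x y1 y2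
  proof -
    have "\<mu> * (norm (y1 - y2))\<^sup>2 = (\<Sum>i<T. \<mu> * block (coord (y1 - y2)) i)"
      by (simp only: sum_block[OF subspace_diff[OF subspace_Rn that], symmetric] sum_distrib_left)
    also have "\<dots> \<le> (\<Sum>i<T. energy (coord (y1 - y2)) (coord (y1 - y2)) i)"
      by (intro sum_mono coercive)
    finally have "\<mu> * (norm (y1 - y2))\<^sup>2 \<le> \<dots>" .
    moreover have "inner (snd (grad (x, y2))) (y1 - y2) = dobj (x, y2) (0, y1 - y2)"
      by (simp add: inner_grad[symmetric] inner_prod_def)
    ultimately show ?thesis using obj_diff_snd[of x y1 y2] by simp
  qed
  \<comment> \<open>With all nodes at the source value no link is stretched and every potential is
    at its minimum, so all terms are minimal at once.\<close>
  define x0 where "x0 = vec T (\<lambda>_. \<sigma>)"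
  have node_x0: "node \<sigma> x0 i = \<sigma>" if "i \<le> T" for i
    using that by (cases i) (auto simp: x0_def)
  have "reduced x0 = (\<Sum>i<T. - (s * \<sigma>\<^sup>2 / 4))"
    unfolding reduced_def by (rule sum.cong) (auto simp: node_x0 bend_self[OF \<sigma>] simp del: node_simps)
  then have x0: "reduced x0 = - (real T * s * \<sigma>\<^sup>2 / 4)" by simp
  have min: "reduced x0 \<le> reduced x" for x
  proof -
    have "(\<Sum>i<T. 0 + s * (- \<sigma>\<^sup>2 / 4)) \<le> reduced x"
      unfolding reduced_def
      using q_nonneg by (intro sum_mono add_mono mult_left_mono[OF bend_ge[OF \<sigma>] s]) auto
    then show ?thesis by (simp add: x0)
  qed
  have "is_arg_min (max_fun obj (Rn (T*n))) (\<lambda>x. x \<in> Rn T) x0"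
    using min by (auto simp: is_arg_min_linorder max_fun_obj x0_def)
  moreover have "max_fun obj (Rn (T*n)) 0 - max_fun obj (Rn (T*n)) x0 \<le> \<Delta>"
    using gap by (simp add: max_fun_obj reduced_0 x0)
  moreover have "Rn k \<noteq> {}" "0 \<in> Rn k" "convex (Rn k)" for k
    using subspace_0[OF subspace_Rn[of k]] subspace_imp_convex[OF subspace_Rn[of k]] by auto
  ultimately show ?thesis
    unfolding fun_class_def
    using closed_Rn concave grad_lipschitz[OF K1 K2] has_grad_obj by blast
qed

subsection \<open>The zero chain and the gradient of the maximum function\<close>

definition reached :: "nat \<Rightarrow> joint \<Rightarrow> bool" where
  "reached t v \<longleftrightarrow> (\<forall>j. coord (snd v) j \<noteq> 0 \<longrightarrow> j < t) \<and> (\<forall>i. coord (fst v) i \<noteq> 0 \<longrightarrow> n * Suc i \<le> t)"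

text \<open>A partial derivative sees only neighbours in the order along the chain: \<open>C\<close>
  acts on single nodes, and the slope of the potential vanishes at 0. The coupling \<open>e\<close>
  jumps over a whole path, which respects the order only for \<open>n = 1\<close>.\<close>

lemma reached_grad:
  assumes v: "reached t v" and en: "e = 0 \<or> n = 1"
  shows "reached (Suc t) (grad v)"
proof -
  let ?z = "node \<sigma> (fst v)" and ?y = "coord (snd v)"
  have y0: "?y j = 0" if "t \<le> j" for j using v that by (auto simp: reached_def not_less[symmetric])
  have x0: "coord (fst v) i = 0" if "t < n * Suc i" for i
    using v that by (auto simp: reached_def not_less[symmetric])
  have X: "dobj v (unit i, 0) = 0" if i: "Suc t < n * Suc i" for i
    unfolding dobj_def
  proof (rule sum.neutral, safe)
    fix l
    have "coord (fst v) i = 0" "coord (fst v) (Suc i) = 0" using i n by (auto intro!: x0)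
    moreover have "?y (Suc i * n) = 0" "?y (i*n + (n-1)) = 0"
      using i n by (auto intro!: y0 simp: mult.commute)
    \<comment> \<open>With \<open>n = 1\<close> the assumption on \<open>i\<close> excludes
      \<open>i = 0\<close>, so this node is not the source but a coordinate still at zero.\<close>
    moreover have "e * ?z i = 0"
    proof (cases "e = 0")
      case False
      then have "n = 1" using en by simp
      with i obtain i' where "i = Suc i'" "t < n * Suc i'" by (cases i) auto
      then show ?thesis using x0[of i'] by simp
    qed simp
    ultimately show "dlink ?z ?y (node 0 (fst (unit i, 0 :: rvec))) (coord (snd (unit i, 0 :: rvec))) l = 0"
      using \<sigma> e by (cases "l = i"; cases "l = Suc i") (auto simp: dlink_def energy_def)
  qed
  have Y: "dobj v (0, unit j) = 0" if j: "t < j" for j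
    unfolding dobj_def
  proof (rule sum.neutral, safe)
    fix l
    have *: "?z l = 0" if "j = l*n"
      using j that x0[of "l - 1"] by (cases l) (auto simp: mult.commute)
    have **: "coord (fst v) l = 0" if "j = l*n + (n-1)"
      using j that n by (intro x0) (auto simp: mult.commute)
    have "?y j = 0" "?y (Suc j) = 0" "?y (j - 1) = 0"
      using j by (auto intro!: y0)
    then have "(?y (l*n + k) - ?y (l*n + Suc k)) * (of_bool (l*n + k = j) - of_bool (l*n + Suc k = j)) = 0" for k
      by (cases "l*n + k = j"; cases "l*n + Suc k = j") auto
    then have edges: "(\<Sum>k<n-1. (?y (l*n + k) - ?y (l*n + Suc k))
        * (coord (unit j) (l*n + k) - coord (unit j) (l*n + Suc k))) = 0"
      unfolding coord_unit by (intro sum.neutral ballI)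
    have "?y i * coord (unit j) i = 0" for i
      using \<open>?y j = 0\<close> by (cases "i = j") auto
    then have "energy ?y (coord (unit j)) l = 0"
      by (simp only: energy_def edges mult_zero_right add_0)
    with * ** show "dlink ?z ?y (node 0 (fst (0 :: rvec, unit j))) (coord (snd (0 :: rvec, unit j))) l = 0"
      by (auto simp: dlink_def)
  qed
  show ?thesis
    unfolding reached_def
  proof (intro conjI allI impI)
    fix j assume "coord (snd (grad v)) j \<noteq> 0"
    then have "dobj v (0, unit j) \<noteq> 0" by (auto simp: grad_def joint_vec_def split: if_splits)
    then show "j < Suc t" using Y[of j] by linarith
  next
    fix i assume "coord (fst (grad v)) i \<noteq> 0"
    then have "dobj v (unit i, 0) \<noteq> 0" by (auto simp: grad_def joint_vec_def split: if_splits)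
    then show "n * Suc i \<le> Suc t" using X[of i] by (meson not_less)
  qed
qed

text \<open>The invariant passes to unions of supports by monotonicity in \<open>t\<close>. The
  domain is a whole subspace containing \<open>w\<close>, so projecting leaves \<open>w\<close>
  fixed and creates no new support.\<close>

lemma reached_iterates:
  assumes en: "e = 0 \<or> n = 1"
    and Orc: "first_order_oracle T (T*n) (Rn T \<times> Rn (T*n)) obj Orc"
    and alg: "zero_respecting (Rn T \<times> Rn (T*n)) Orc v" and v0: "v 0 = 0"
  shows "reached t (v t) \<and> v t \<in> Rn T \<times> Rn (T*n)"
proof (induction t rule: less_induct)
  case (less t)
  let ?V = "Rn T \<times> Rn (T*n)"
  have sub: "subspace ?V" by (simp add: subspace_Times subspace_Rn)
  show ?case
  proof (cases t)
    case 0
    then show ?thesis using v0 subspace_0[OF sub] by (simp add: reached_def zero_prod_def)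
  next
    case (Suc t')
    have prev: "reached t (v i) \<and> v i \<in> ?V \<and> reached t (snd (Orc (v i))) \<and> snd (Orc (v i)) \<in> ?V"
      if "i \<le> t'" for i
    proof -
      have mono: "reached k u \<Longrightarrow> k \<le> t \<Longrightarrow> reached t u" for k u
        by (meson order_less_le_trans order_trans reached_def)
      have i: "reached i (v i)" "v i \<in> ?V" using less.IH[of i] that Suc by auto
      have "snd (Orc (v i)) = grad (v i)"
        by (rule has_grad_unique[OF sub i(2) _ has_grad_obj])
          (rule bspec[OF Orc[unfolded first_order_oracle_def] i(2), THEN conjunct2])
      moreover have "grad (v i) \<in> ?V" by (simp add: grad_def)
      ultimately show ?thesis
        using i that Suc mono[OF i(1)] mono[OF reached_grad[OF i(1) en]] by auto
    qed
    obtain w where w: "jsupp w \<subseteq> (\<Union>i\<le>t'. jsupp (v i) \<union> jsupp (snd (Orc (v i))))"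
      and proj: "is_proj ?V w (v t)"
      using alg Suc unfolding zero_respecting_def by blast
    have fst_w: "n * Suc i \<le> t \<and> i < T" if "coord (fst w) i \<noteq> 0" for i
    proof -
      have "Inl i \<in> jsupp w" using that by (auto simp: jsupp_def supp_def)
      with w obtain k where "k \<le> t'" "Inl i \<in> jsupp (v k) \<or> Inl i \<in> jsupp (snd (Orc (v k)))" by auto
      then show ?thesis using prev[of k]
        by (auto simp: jsupp_def supp_def reached_def mem_Times_iff dest: less_if_mem_Rn)
    qed
    have snd_w: "j < t \<and> j < T*n" if "coord (snd w) j \<noteq> 0" for j
    proof -
      have "Inr j \<in> jsupp w" using that by (auto simp: jsupp_def supp_def)
      with w obtain k where "k \<le> t'" "Inr j \<in> jsupp (v k) \<or> Inr j \<in> jsupp (snd (Orc (v k)))" by auto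
      then show ?thesis using prev[of k]
        by (auto simp: jsupp_def supp_def reached_def mem_Times_iff dest: less_if_mem_Rn)
    qed
    have "reached t w" using fst_w snd_w by (auto simp: reached_def)
    moreover have "w \<in> ?V" using fst_w snd_w by (fastforce simp: Rn_def mem_Times_iff)
    moreover from this have "dist w (v t) \<le> dist w w"
      using proj unfolding is_proj_def is_arg_min_linorder by blast
    then have "v t = w" by simp
    ultimately show ?thesis by simp
  qed
qed

text \<open>If all partial derivatives were at most \<open>\<epsilon>\<close>, the chain read from
  its vanishing free end would satisfy the recursion with \<open>c = \<epsilon> / q\<close> and stay
  below \<sigma>, yet it ends at the source. For a single link without potential the derivative is
  \<open>- q * \<sigma>\<close> outright.\<close>

lemma large_gradient:
  assumes x: "coord x (T - 1) = 0" and \<epsilon>: "0 < \<epsilon>" "8 * \<epsilon> \<le> q * \<sigma>"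
    and s_eq: "s = q \<or> s = 0 \<and> T = 1"
  shows "\<exists>g. has_grad (Rn T) (max_fun obj (Rn (T*n))) g x (Rn T) \<and> norm g > \<epsilon>"
proof -
  have q: "0 < q" using \<epsilon> \<sigma> q_nonneg by (cases "q = 0") auto
  define g where "g = vec T (\<lambda>i. dreduced x (unit i))"
  have lin: "linear (dreduced x)" by (rule has_derivative_linear[OF reduced_deriv])
  have "dreduced x h = 0" if "\<And>i. i < T \<Longrightarrow> coord h i = 0" for h
    unfolding dreduced_def using that by (intro sum.neutral) (auto simp: node_def split: nat.split)
  from riesz_Rn[OF lin this] have "dreduced x = (\<lambda>h. inner g h)" by (auto simp: g_def)
  then have "has_grad (Rn T) reduced g x (Rn T)"
    using reduced_deriv[of x "Rn T"] by (simp add: has_grad_def g_def)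
  moreover have "max_fun obj (Rn (T*n)) = reduced" by (rule ext) (rule max_fun_obj)
  moreover have "norm g > \<epsilon>"
  proof (rule ccontr)
    assume "\<not> norm g > \<epsilon>"
    then have "\<bar>coord g i\<bar> \<le> \<epsilon>" for i using coord_le_norm[of g i] by linarith
    then have small: "\<bar>dreduced x (unit i)\<bar> \<le> \<epsilon>" if "i < T" for i
      using that by (metis coord_vec g_def)
    let ?z = "node \<sigma> x"
    \<comment> \<open>Node \<open>Suc i\<close> belongs to links \<open>i\<close> and
      \<open>Suc i\<close>; the latter is absent at the free end.\<close>
    have d: "dreduced x (unit i) = q * (?z (Suc i) - ?z i)
        + (if Suc i < T then q * (?z (Suc i) - ?z (Suc (Suc i))) else 0) + s * bend' \<sigma> (?z (Suc i))"
      if "i < T" for i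
    proof -
      have "dreduced x (unit i) = (\<Sum>l<T. (if l = i then q * (?z (Suc i) - ?z i) + s * bend' \<sigma> (?z (Suc i)) else 0)
          + (if l = Suc i then q * (?z (Suc i) - ?z (Suc (Suc i))) else 0))"
        unfolding dreduced_def by (rule sum.cong) (auto simp: algebra_simps)
      also have "\<dots> = (q * (?z (Suc i) - ?z i) + s * bend' \<sigma> (?z (Suc i)))
          + (if Suc i < T then q * (?z (Suc i) - ?z (Suc (Suc i))) else 0)"
        using that by (simp add: sum.distrib)
      finally show ?thesis by simp
    qed
    show False
    proof (cases "s = q")
      case False
      then have "T = 1" "s = 0" using s_eq by auto
      then show False using d[of 0] small[of 0] x \<epsilon> q \<sigma> by (simp add: abs_mult)
    next
      case True
      \<comment> \<open>Reversed order: \<open>u 0\<close> is the free end and \<open>u T\<close> is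
        the source.\<close>
      define u where "u k = ?z (T - k)" for k
      have "u T < \<sigma>"
      proof (rule recursion_below_source)
        show "u 0 = 0" using x T by (cases T) (auto simp: u_def)
        then have u0: "?z T = 0" by (simp add: u_def)
        show "0 < \<epsilon> / q" "8 * (\<epsilon> / q) \<le> \<sigma>" using \<epsilon> q by (auto simp: field_simps)
        fix k assume k: "k < T"
        define i where "i = T - Suc k"
        have i: "T - Suc k = i" "T - k = Suc i" "T - (k - 1) = (if Suc i < T then Suc (Suc i) else T)" "i < T"
          using k by (auto simp: i_def)
        have "dreduced x (unit i) = - q * (u (Suc k) - 2 * u k + u (k - 1) - bend' \<sigma> (u k))"
        proof (cases "Suc i < T")
          case True
          then show ?thesis unfolding d[OF i(4)] u_def i using \<open>s = q\<close>
            by (simp add: algebra_simps)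
        next
          case False
          then have "Suc i = T" using i by simp
          then show ?thesis unfolding d[OF i(4)] u_def i using \<open>s = q\<close> u0
            by (simp add: algebra_simps del: node_simps)
        qed
        then have "\<bar>u (Suc k) - 2 * u k + u (k - 1) - bend' \<sigma> (u k)\<bar> * q \<le> \<epsilon>"
          using small[OF i(4)] q by (simp only: abs_mult abs_minus_cancel abs_of_pos mult.commute)
        then show "\<bar>u (Suc k) - 2 * u k + u (k - 1) - bend' \<sigma> (u k)\<bar> \<le> \<epsilon> / q"
          using q by (simp add: pos_le_divide_eq)
      qed
      then show False by (simp add: u_def)
    qed
  qed
  ultimately show ?thesis by auto
qed

text \<open>For \<open>t < n * T\<close> the invariant keeps the last node at zero, and
  \<open>large_gradient\<close> applies. If \<open>\<tau> < 1\<close>, the claim on iterates is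
  empty and only a member of the class has to be supplied.\<close>

lemma hard_instance:
  assumes en: "e = 0 \<or> n = 1" and \<epsilon>: "0 < \<epsilon>"
    and K1: "2 * a + 4 * C + 4 * e + s \<le> L" and K2: "2 * a + 4 * b + 2 * \<theta> \<le> L"
    and coercive: "\<And>w i. \<mu> * block w i \<le> energy w w i"
    and gap: "q / 2 * \<sigma>\<^sup>2 + real T * s * \<sigma>\<^sup>2 / 4 \<le> \<Delta>"
    and hard: "\<tau> < 1 \<or> 8 * \<epsilon> \<le> q * \<sigma> \<and> (s = q \<or> s = 0 \<and> T = 1) \<and> \<tau> < real n * real T"
  shows "\<exists>m n f. m > 0 \<and> n > 0 \<and> f \<in> fun_class L \<mu> \<Delta> m n (Rn m) (Rn n) \<and>
           (\<forall>Orc A t.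
              first_order_oracle m n (Rn m \<times> Rn n) f Orc \<and>
              first_order_algorithm A \<and>
              A m n (Rn m \<times> Rn n) Orc 0 = 0 \<and>
              1 \<le> \<tau> \<and> real t \<le> \<tau> \<longrightarrow>
              (\<exists>g. has_grad (Rn m) (max_fun f (Rn n)) g
                     (fst (A m n (Rn m \<times> Rn n) Orc t)) (Rn m) \<and>
                   norm g > \<epsilon>))"
proof (rule exI[of _ T], rule exI[of _ "T*n"], rule exI[of _ obj], intro conjI allI impI; (elim conjE)?)
  show "0 < T" "0 < T*n" using T n by auto
  show "obj \<in> fun_class L \<mu> \<Delta> T (T*n) (Rn T) (Rn (T*n))"
    by (rule obj_mem_fun_class[OF K1 K2 coercive gap])
  let ?V = "Rn T \<times> Rn (T*n)"
  fix Orc A t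
  assume Orc: "first_order_oracle T (T*n) ?V obj Orc" and alg: "first_order_algorithm A"
    and init: "A T (T*n) ?V Orc 0 = 0" and \<tau>: "1 \<le> \<tau>" "real t \<le> \<tau>"
  have sub: "subspace ?V" by (simp add: subspace_Times subspace_Rn)
  have "?V \<noteq> {} \<and> closed ?V \<and> convex ?V \<and> ?V \<subseteq> ?V"
    using subspace_0[OF sub] subspace_imp_convex[OF sub] closed_Times[OF closed_Rn closed_Rn] by blast
  with alg Orc have zr: "zero_respecting ?V Orc (A T (T*n) ?V Orc)"
    unfolding first_order_algorithm_def by blast
  have reached: "reached t (A T (T*n) ?V Orc t)"
    using reached_iterates[OF en Orc zr init] by blast
  have hard': "8 * \<epsilon> \<le> q * \<sigma>" "s = q \<or> s = 0 \<and> T = 1" and "\<tau> < real n * real T"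
    using hard \<tau> by auto
  then have "t < n * T" using \<tau> by (metis of_nat_less_iff of_nat_mult order_le_less_trans)
  then have "coord (fst (A T (T*n) ?V Orc t)) (T - 1) = 0"
    using reached T unfolding reached_def by (metis Suc_diff_1 not_less)
  from large_gradient[OF this \<epsilon> hard']
  show "\<exists>g. has_grad (Rn T) (max_fun obj (Rn (T*n))) g (fst (A T (T*n) ?V Orc t)) (Rn T) \<and> norm g > \<epsilon>" .
qed

text \<open>Both ends coincide, so the grounding counts twice.\<close>

lemma coercive_single:
  assumes "n = 1" "\<mu> \<le> 2 * \<theta>"
  shows "\<mu> * block w i \<le> energy w w i"
  unfolding block_def energy_def
  using mult_right_mono[OF assms(2), of "(w i)\<^sup>2"] assms(1)
  by (simp add: power2_eq_square)

lemma coercive_path: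
  assumes "0 \<le> \<mu>" "2 * (real n)\<^sup>2 * \<mu> \<le> b" "2 * real n * \<mu> \<le> \<theta>"
  shows "\<mu> * block w i \<le> energy w w i"
  using path_poincare[OF assms, of "\<lambda>k. w (i*n + k)"]
  by (simp add: block_def energy_def power2_eq_square)

end

section \<open>Choice of the parameters\<close>

text \<open>The edges take a fixed share of the smoothness budget, and the grounding is the least
  that \<open>coercive_path\<close> accepts. With \<open>a\<close> of order L/sqrt(n) the correction
  \<open>C\<close> stays of order \<open>L\<close>, while \<open>q\<close> has order L^2/(n^2
  \<mu>).\<close>

lemma long_chain:
  fixes n T :: nat and L \<mu> s \<sigma> :: real
  assumes "0 < T" "0 < n" "0 < \<mu>" "0 < L" "0 \<le> s" "0 \<le> \<sigma>"
  shows "chain T n (L / (8 * sqrt (real n))) (L/16) (2 * real n * \<mu>) 0 s \<sigma>"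
  using assms by unfold_locales auto

lemma long_chain_bounds:
  fixes n :: nat and L \<mu> :: real
  assumes n: "0 < n" and \<mu>: "0 < \<mu>" and L: "0 < L" and n2: "32 * (real n)\<^sup>2 * \<mu> \<le> L"
  defines "a \<equiv> L / (8 * sqrt (real n))"
  shows "4 * chain.C n a (L/16) (2 * real n * \<mu>) \<le> L / 4"
    and "2 * a \<le> L / 4"
    and "2 * a + 4 * (L/16) + 2 * (2 * real n * \<mu>) \<le> L"
    and "L\<^sup>2 / (384 * (real n)\<^sup>2 * \<mu>) \<le> chain.q n a (L/16) (2 * real n * \<mu>) 0"
    and "chain.q n a (L/16) (2 * real n * \<mu>) 0 \<le> L\<^sup>2 / (256 * (real n)\<^sup>2 * \<mu>)"
proof -
  interpret chain 1 n a "L/16" "2 * real n * \<mu>" 0 0 0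
    unfolding a_def by (rule long_chain) (use n \<mu> L in auto)
  have n1: "1 \<le> real n" using n by simp
  have a2: "a\<^sup>2 = L\<^sup>2 / (64 * real n)" by (simp add: a_def power_divide power_mult_distrib)
  have "L / (8 * sqrt (real n)) \<le> L / (8 * 1)"
    using L n1 by (intro divide_left_mono) auto
  then show a: "2 * a \<le> L / 4" by (simp add: a_def)
  have "real n * \<mu> \<le> (real n)\<^sup>2 * \<mu>"
    using n1 \<mu> by (intro mult_right_mono) (auto simp: power2_eq_square)
  then show "2 * a + 4 * (L/16) + 2 * (2 * real n * \<mu>) \<le> L"
    using a n2 L by linarith
  \<comment> \<open>The path length bound makes this quantity lie in [0, 1], so the denominator
    \<open>\<rho> + 2\<close> is between 2 and 3; hence the constants 256 and 384.\<close>
  define \<rho> where "\<rho> = 2 * real n * \<mu> * R"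
  have "\<rho> = 32 * real n * \<mu> * (real n - 1) / L" by (simp add: \<rho>_def R_def)
  also have "\<dots> \<le> 1"
  proof -
    have "32 * real n * \<mu> * (real n - 1) \<le> 32 * real n * \<mu> * real n"
      using \<mu> by (intro mult_left_mono) auto
    also have "\<dots> = 32 * (real n)\<^sup>2 * \<mu>" by (simp add: power2_eq_square)
    finally show ?thesis using n2 L by simp
  qed
  finally have \<rho>1: "\<rho> \<le> 1" .
  have \<rho>0: "0 \<le> \<rho>" using R_nonneg \<mu> by (simp add: \<rho>_def)
  have "C = a\<^sup>2 * R / (2 * (\<rho> + 2))" by (simp add: C_def \<rho>_def)
  also have "\<dots> \<le> a\<^sup>2 * R / (2 * 2)"
    using \<rho>0 R_nonneg by (intro divide_left_mono) auto
  also have "\<dots> = L / 16 * ((real n - 1) / real n)"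
    unfolding a2 R_def using L n1 by (simp add: power2_eq_square field_simps)
  also have "\<dots> \<le> L / 16 * 1"
    using L n1 by (intro mult_left_mono) auto
  finally show "4 * C \<le> L / 4" by simp
  have q: "q = L\<^sup>2 / (128 * (real n)\<^sup>2 * \<mu> * (\<rho> + 2))"
    unfolding q_def \<rho>_def[symmetric] a2
    by (simp add: power2_eq_square mult.assoc mult.commute mult.left_commute)
  show "L\<^sup>2 / (384 * (real n)\<^sup>2 * \<mu>) \<le> q"
    unfolding q using \<rho>0 \<rho>1 n1 \<mu> by (intro divide_left_mono) (auto intro!: mult_pos_pos)
  show "q \<le> L\<^sup>2 / (256 * (real n)\<^sup>2 * \<mu>)"
    unfolding q using \<rho>0 \<rho>1 n1 \<mu> by (intro divide_left_mono) (auto intro!: mult_pos_pos)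
qed

lemma nat_floor_ge_half: "x / 2 \<le> real (nat \<lfloor>x\<rfloor>)" if "1 \<le> x" for x :: real
proof -
  have "1 \<le> \<lfloor>x\<rfloor>" using that by simp
  then show ?thesis by linarith
qed

lemma hard_function_exists:
  fixes \<mu> L \<Delta> \<epsilon> \<tau> :: real
  assumes \<mu>: "0 < \<mu>" and L: "0 < L" and \<Delta>: "0 < \<Delta>" and \<epsilon>: "0 < \<epsilon>" and \<kappa>1: "1 \<le> L / \<mu>"
    and \<tau>_def: "\<tau> = 1/100000 * L * \<Delta> * sqrt (L / \<mu>) / \<epsilon>\<^sup>2"
  shows "\<exists>m n f. m > 0 \<and> n > 0 \<and> f \<in> fun_class L \<mu> \<Delta> m n (Rn m) (Rn n) \<and>
           (\<forall>Orc A t.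
              first_order_oracle m n (Rn m \<times> Rn n) f Orc \<and>
              first_order_algorithm A \<and>
              A m n (Rn m \<times> Rn n) Orc 0 = 0 \<and>
              1 \<le> \<tau> \<and> real t \<le> \<tau> \<longrightarrow>
              (\<exists>g. has_grad (Rn m) (max_fun f (Rn n)) g
                     (fst (A m n (Rn m \<times> Rn n) Orc t)) (Rn m) \<and>
                   norm g > \<epsilon>))"
proof -
  define \<kappa> \<delta> where "\<kappa> = L / \<mu>" and "\<delta> = L * \<Delta> / \<epsilon>\<^sup>2"
  have \<tau>_eq: "\<tau> = \<delta> * sqrt \<kappa> / 100000" by (simp add: \<tau>_def \<delta>_def \<kappa>_def)
  have \<Delta>_eq: "\<Delta> = \<delta> * (\<epsilon>\<^sup>2 / L)" using L \<epsilon> by (simp add: \<delta>_def)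
  have \<delta>: "0 < \<delta>" using L \<Delta> \<epsilon> by (simp add: \<delta>_def)
  have \<epsilon>L: "0 < \<epsilon>\<^sup>2 / L" using L \<epsilon> by simp
  have \<mu>L: "\<mu> \<le> L" using \<kappa>1 \<mu> by (simp add: field_simps)
  have L_eq: "L = \<kappa> * \<mu>" using \<mu> by (simp add: \<kappa>_def)
  have \<kappa>: "1 \<le> \<kappa>" using \<kappa>1 by (simp add: \<kappa>_def)
  \<comment> \<open>The value 32 is where the admissible path length sqrt(\<kappa>/32) reaches 1,
    and 1000 is the share of \<open>\<delta>\<close> budgeted for each link.\<close>
  consider "\<tau> < 1" | "1 \<le> \<tau>" "\<kappa> \<le> 32" | "1 \<le> \<tau>" "32 < \<kappa>" "1000 \<le> \<delta>"
    | "1 \<le> \<tau>" "32 < \<kappa>" "\<delta> < 1000" by linarith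
  then show ?thesis
  proof cases
    case 1
    \<comment> \<open>The objective is just the concave quadratic -\<mu> y^2/2 in one variable
      y.\<close>
    interpret chain 1 1 0 0 "\<mu>/2" 0 0 0
      using \<mu> by unfold_locales auto
    show ?thesis
      by (rule hard_instance[OF _ \<epsilon> _ _ coercive_single])
        (use 1 \<mu>L \<mu> L \<Delta> in \<open>auto simp: C_def q_def simp del: One_nat_def\<close>)
  next
    case 2
    define T where "T = nat \<lfloor>\<tau>\<rfloor> + 1"
    \<comment> \<open>Here \<open>a = 0\<close> decouples y, so \<open>q = e = s\<close>, and the
      source value is chosen to give \<open>q * \<sigma> = 8 * \<epsilon>\<close>.\<close>
    interpret chain T 1 0 0 "\<mu>/2" "L/8" "L/8" "64 * \<epsilon> / L"
      using \<mu> L \<epsilon> by unfold_locales (auto simp: T_def)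
    have "sqrt \<kappa> \<le> 6" using 2 by (intro real_le_lsqrt) auto
    then have "\<tau> \<le> \<delta> * 6 / 100000" unfolding \<tau>_eq using \<delta> by simp
    moreover have T\<tau>: "\<tau> < real T" "real T \<le> 2 * \<tau>" using 2 unfolding T_def by linarith+
    ultimately have T\<delta>: "512 * real T \<le> \<delta>" using \<delta> by linarith
    have T1: "1 \<le> real T" using T by linarith
    have q: "q = L / 8" unfolding q_def by simp
    have "q / 2 * (64 * \<epsilon> / L)\<^sup>2 + real T * (L/8) * (64 * \<epsilon> / L)\<^sup>2 / 4
        = 512 * (1/2 + real T / 4) * (\<epsilon>\<^sup>2 / L)"
      unfolding q using L by (simp add: field_simps power2_eq_square)
    also have "\<dots> \<le> \<delta> * (\<epsilon>\<^sup>2 / L)"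
      using T\<delta> T1 \<epsilon>L by (intro mult_right_mono) auto
    finally have gap: "q / 2 * (64 * \<epsilon> / L)\<^sup>2 + real T * (L/8) * (64 * \<epsilon> / L)\<^sup>2 / 4 \<le> \<Delta>"
      by (simp only: \<Delta>_eq)
    show ?thesis
      by (rule hard_instance[OF _ \<epsilon> _ _ coercive_single gap])
        (use \<mu>L L T\<tau> in \<open>auto simp: C_def q simp del: One_nat_def\<close>)
  next
    case 3
    \<comment> \<open>The largest real solution of 32 r^2 \<mu> <= L.\<close>
    define r where "r = sqrt (\<kappa> / 32)"
    define n where "n = nat \<lfloor>r\<rfloor>"
    define T where "T = nat \<lfloor>\<delta> / 1000\<rfloor>"
    define a where "a = L / (8 * sqrt (real n))"
    have r1: "1 \<le> r" using 3 by (simp add: r_def)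
    have n_bounds: "r / 2 \<le> real n" "real n \<le> r" "0 < n"
      using nat_floor_ge_half[OF r1] r1 unfolding n_def by linarith+
    have T_bounds: "\<delta> / 2000 \<le> real T" "real T \<le> \<delta> / 1000" "0 < T"
      using nat_floor_ge_half[of "\<delta> / 1000"] 3 unfolding T_def by linarith+
    have r2: "r\<^sup>2 = \<kappa> / 32" using \<kappa> by (simp add: r_def)
    have n_sq: "(real n)\<^sup>2 \<le> \<kappa> / 32" "\<kappa> / 128 \<le> (real n)\<^sup>2"
      using power_mono[OF n_bounds(2), of 2] power_mono[OF n_bounds(1), of 2] r1 r2 by (auto simp: power_divide)
    have n2: "32 * (real n)\<^sup>2 * \<mu> \<le> L"
      unfolding L_eq using n_sq \<mu> by (intro mult_right_mono) auto
    define q where "q = chain.q n a (L/16) (2 * real n * \<mu>) 0"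
    have "L\<^sup>2 / (256 * (real n)\<^sup>2 * \<mu>) \<le> L / 2"
    proof -
      have "\<kappa> * \<mu> \<le> 128 * (real n)\<^sup>2 * \<mu>" using n_sq \<mu> by (intro mult_right_mono) auto
      then show ?thesis using L n_bounds \<mu> by (simp add: L_eq[symmetric] field_simps power2_eq_square)
    qed
    moreover have "L / 12 \<le> L\<^sup>2 / (384 * (real n)\<^sup>2 * \<mu>)"
      using n2 L n_bounds \<mu> by (simp add: field_simps power2_eq_square)
    moreover note bounds = long_chain_bounds[OF \<open>0 < n\<close> \<mu> L n2, folded a_def]
    \<comment> \<open>A path of nearly maximal length makes \<open>q\<close> comparable to
      \<open>L\<close>: the upper bound lets \<open>s = q\<close> fit the smoothness budget, and the
      lower one bounds the gap.\<close>
    ultimately have q: "L / 12 \<le> q" "q \<le> L / 2"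
      using bounds(4,5) unfolding q_def by linarith+
    then have q0: "0 < q" using L by linarith
    define \<sigma> where "\<sigma> = 8 * \<epsilon> / q"
    \<comment> \<open>\<open>chain.q\<close> depends on neither \<open>s\<close> nor \<sigma>, so
      setting \<open>s = q\<close> is not circular.\<close>
    interpret chain T n a "L/16" "2 * real n * \<mu>" 0 q \<sigma>
      rewrites "chain.q n a (L/16) (2 * real n * \<mu>) 0 \<equiv> q"
      using long_chain[OF \<open>0 < T\<close> \<open>0 < n\<close> \<mu> L, of q \<sigma>] q0 \<epsilon>
      by (auto simp: a_def \<sigma>_def q_def)
    have "q / 2 * \<sigma>\<^sup>2 + real T * q * \<sigma>\<^sup>2 / 4 = 64 * \<epsilon>\<^sup>2 * (1/2 + real T / 4) / q"
      using q0 by (simp add: \<sigma>_def field_simps power2_eq_square)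
    also have "\<dots> \<le> 64 * \<epsilon>\<^sup>2 * (1/2 + real T / 4) / (L / 12)"
      using q L q0 by (intro divide_left_mono) auto
    also have "\<dots> = 768 * (1/2 + real T / 4) * (\<epsilon>\<^sup>2 / L)" by simp
    also have "\<dots> \<le> \<delta> * (\<epsilon>\<^sup>2 / L)"
    proof (rule mult_right_mono)
      have "1 \<le> real T" using T_bounds by simp
      then have "768 * (1/2 + real T / 4) \<le> 1000 * real T" by (simp add: distrib_left)
      also have "\<dots> \<le> \<delta>" using T_bounds(2) by simp
      finally show "768 * (1/2 + real T / 4) \<le> \<delta>" .
    qed (use \<epsilon>L in simp)
    finally have gap: "q / 2 * \<sigma>\<^sup>2 + real T * q * \<sigma>\<^sup>2 / 4 \<le> \<Delta>" by (simp only: \<Delta>_eq)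
    have "\<tau> < real n * real T"
    proof -
      have "sqrt \<kappa> / 6 \<le> r"
        unfolding r_def real_sqrt_divide using \<kappa>
        by (intro divide_left_mono real_le_lsqrt) auto
      then have "sqrt \<kappa> / 12 * (\<delta> / 2000) \<le> real n * real T"
        using n_bounds T_bounds \<delta> \<kappa> by (intro mult_mono) auto
      moreover have "sqrt \<kappa> / 12 * (\<delta> / 2000) = \<delta> * sqrt \<kappa> / 24000" by simp
      moreover have "0 < \<delta> * sqrt \<kappa>" using \<delta> \<kappa> by simp
      ultimately show ?thesis unfolding \<tau>_eq by linarith
    qed
    moreover have "8 * \<epsilon> \<le> q * \<sigma>" using q0 by (simp add: \<sigma>_def)
    ultimately show ?thesis
      using bounds(1-3) q \<mu> n2 q0
      by (intro hard_instance[OF _ \<epsilon> _ _ coercive_path gap]) auto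
  next
    case 4
    \<comment> \<open>With one link and no potential, \<open>q\<close> may exceed \<open>L\<close>.
      The path is only as long as the step count requires, since a shorter path is stiffer and the
      gap is of order \<epsilon>^2/q.\<close>
    define n where "n = nat \<lfloor>\<tau>\<rfloor> + 1"
    define a where "a = L / (8 * sqrt (real n))"
    have n_bounds: "\<tau> < real n" "real n \<le> 2 * \<tau>" "0 < n" using 4 unfolding n_def by linarith+
    have "(real n)\<^sup>2 \<le> (2 * \<tau>)\<^sup>2" using n_bounds by (intro power_mono) auto
    also have "\<dots> = \<delta>\<^sup>2 * \<kappa> / 2500000000"
      using \<kappa> by (simp add: \<tau>_eq power_mult_distrib power_divide)
    finally have n_sq: "(real n)\<^sup>2 \<le> \<delta>\<^sup>2 * \<kappa> / 2500000000" .
    \<comment> \<open>Both the path length bound and the gap are quadratic in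
      \<open>\<delta>\<close>; the bound 1000 makes the gap estimate linear.\<close>
    have \<delta>2: "\<delta>\<^sup>2 \<le> 1000 * \<delta>" using 4 \<delta> by (simp add: power2_eq_square)
    have "\<delta>\<^sup>2 * \<kappa> \<le> 1000000 * \<kappa>" using \<delta>2 4 \<kappa> by (intro mult_right_mono) auto
    then have "32 * (real n)\<^sup>2 \<le> \<kappa>" using n_sq \<kappa> by linarith
    then have n2: "32 * (real n)\<^sup>2 * \<mu> \<le> L"
      unfolding L_eq using \<mu> by (intro mult_right_mono) auto
    define q where "q = chain.q n a (L/16) (2 * real n * \<mu>) 0"
    note bounds = long_chain_bounds[OF \<open>0 < n\<close> \<mu> L n2, folded a_def]
    have ql: "L\<^sup>2 / (384 * (real n)\<^sup>2 * \<mu>) \<le> q"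
      using bounds(4) unfolding q_def by simp
    moreover have ql0: "0 < L\<^sup>2 / (384 * (real n)\<^sup>2 * \<mu>)" using L n_bounds \<mu> by simp
    ultimately have q0: "0 < q" by linarith
    define \<sigma> where "\<sigma> = 8 * \<epsilon> / q"
    interpret chain 1 n a "L/16" "2 * real n * \<mu>" 0 0 \<sigma>
      rewrites "chain.q n a (L/16) (2 * real n * \<mu>) 0 \<equiv> q"
      using long_chain[OF zero_less_one \<open>0 < n\<close> \<mu> L, of 0 \<sigma>] q0 \<epsilon>
      by (auto simp: a_def \<sigma>_def q_def)
    have "q / 2 * \<sigma>\<^sup>2 + real 1 * 0 * \<sigma>\<^sup>2 / 4 = 32 * \<epsilon>\<^sup>2 / q"
      using q0 by (simp add: \<sigma>_def field_simps power2_eq_square)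
    also have "\<dots> \<le> 32 * \<epsilon>\<^sup>2 / (L\<^sup>2 / (384 * (real n)\<^sup>2 * \<mu>))"
      by (intro divide_left_mono ql mult_pos_pos q0 ql0) simp
    also have "\<dots> = 12288 * (real n)\<^sup>2 / \<kappa> * (\<epsilon>\<^sup>2 / L)"
      using L by (simp add: \<kappa>_def power2_eq_square)
    also have "\<dots> \<le> \<delta> * (\<epsilon>\<^sup>2 / L)"
    proof (rule mult_right_mono)
      have "12288 * (real n)\<^sup>2 \<le> \<delta>\<^sup>2 * \<kappa> / 1000" using n_sq zero_le_power2[of "real n"] by linarith
      also have "\<dots> \<le> \<delta> * \<kappa>" using mult_right_mono[OF \<delta>2, of \<kappa>] \<kappa> by simp
      finally show "12288 * (real n)\<^sup>2 / \<kappa> \<le> \<delta>" using \<kappa> by (simp add: field_simps)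
    qed (use \<epsilon>L in simp)
    finally have gap: "q / 2 * \<sigma>\<^sup>2 + real 1 * 0 * \<sigma>\<^sup>2 / 4 \<le> \<Delta>" by (simp only: \<Delta>_eq)
    have "8 * \<epsilon> \<le> q * \<sigma>" using q0 by (simp add: \<sigma>_def)
    then show ?thesis
      using bounds(1-3) \<mu> n2 n_bounds L
      by (intro hard_instance[OF _ \<epsilon> _ _ coercive_path gap]) auto
  qed
qed

theorem theorem1:
  "\<exists>c0::real. c0 > 0 \<and>
     (\<forall>\<mu> L \<Delta> \<epsilon> :: real.
        \<mu> > 0 \<and> L > 0 \<and> \<Delta> > 0 \<and> \<epsilon> > 0 \<and> L / \<mu> \<ge> 1 \<longrightarrow>
        (\<exists>m n f. m > 0 \<and> n > 0 \<and> f \<in> fun_class L \<mu> \<Delta> m n (Rn m) (Rn n) \<and>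
           (\<forall>Orc A t.
              first_order_oracle m n (Rn m \<times> Rn n) f Orc \<and>
              first_order_algorithm A \<and>
              A m n (Rn m \<times> Rn n) Orc 0 = 0 \<and>
              1 \<le> c0 * L * \<Delta> * sqrt (L / \<mu>) / \<epsilon>\<^sup>2 \<and>
              real t \<le> c0 * L * \<Delta> * sqrt (L / \<mu>) / \<epsilon>\<^sup>2 \<longrightarrow>
              (\<exists>g. has_grad (Rn m) (max_fun f (Rn n)) g
                     (fst (A m n (Rn m \<times> Rn n) Orc t)) (Rn m) \<and>
                   norm g > \<epsilon>))))"
  \<comment> \<open>The strictest demand on the constant comes from many long links, which need it
    below 1/24000.\<close>
  by (intro exI[of _ "1/100000"] conjI allI impI hard_function_exists) auto

end
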